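(* Let $K$ be a commutative ring with identity and $n\ge 1$. For $m\ge 1$ put $P(m)=\mathrm{Schur}(m-1,n,K)$. For $m,k_1,\dots,k_m\ge 1$ define $$\circ: P(m)\times P(k_1)\times\cdots\times P(k_m)\to P(k_1+\cdots+k_m),\qquad (\theta,\theta_1,\dots,\theta_m)\mapsto \theta\boxtimes\theta_1\boxtimes\cdots\boxtimes\theta_m,$$ and let the identity be the identity element of $P(1)=\mathrm{Schur}(0,n,K)=K$. Then $(P(m))_{m\ge 1}$ with these compositions and this identity is an operad (denoted $\mathit{Schur}$).
   Context: Let $V_n$ be the free $K$-module on $x_1,\dots,x_n$. The symmetric group $\Sigma_q$ acts on $V_n^{\otimes q}$ by $\sigma(y_1\otimes\cdots\otimes y_q)=y_{\sigma^{-1}(1)}\otimes\cdots\otimes y_{\sigma^{-1}(q)}$. $\mathrm{Schur}(q,n,K)$ is the algebra of $K$-linear endomorphisms of $V_n^{\otimes q}$ commuting with the action of every $\sigma\in\Sigma_q$; by convention $V_n^{\otimes 0}=K$ and $\mathrm{Schur}(0,n,K)=K$. Inter-degree product $\boxtimes:\mathrm{Schur}(a,n,K)\times\mathrm{Schur}(b,n,K)\to\mathrm{Schur}(a+b,n,K)$: if $a,b\ge1$, $$(f\boxtimes g)(w)=\sum_{\sigma\in L}\sigma\big((f\otimes g)(\sigma^{-1}(w))\big),\quad w\in V_n^{\otimes (a+b)},$$ where $L$ is any complete set of representatives of the left cosets of $\Sigma_a\times\Sigma_b$ in $\Sigma_{a+b}$ (the result does not depend on $L$). If $a=0$ or $b=0$,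 $\boxtimes$ is scalar multiplication by the element of $K$. Iterated products are taken with this (associative) operation. An operad here consists of a sequence of sets $(P(m))_{m\ge1}$, an element $1\in P(1)$, and composition functions $P(m)\times P(k_1)\times\cdots\times P(k_m)\to P(k_1+\cdots+k_m)$, $(\theta,\theta_1,\dots,\theta_m)\mapsto\theta\circ(\theta_1,\dots,\theta_m)$, for all positive integers $m,k_1,\dots,k_m$, satisfying $\theta\circ(1,\dots,1)=\theta=1\circ\theta$ and $$\theta\circ(\theta_1\circ(\theta_{1,1},\dots,\theta_{1,k_1}),\dots,\theta_m\circ(\theta_{m,1},\dots,\theta_{m,k_m}))=(\theta\circ(\theta_1,\dots,\theta_m))\circ(\theta_{1,1},\dots,\theta_{1,k_1},\dots,\theta_{m,1},\dots,\theta_{m,k_m})$$ (no symmetric group actions are part of the structure). *)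

theory Defs
  imports "HOL-Library.FuncSet" "HOL-Combinatorics.Permutations"
begin

text \<open>The sort \<open>{comm_ring, comm_monoid_mult}\<close> is that of commutative rings with identity;
  unlike \<open>comm_ring_1\<close> it does not exclude the zero ring.\<close>

section \<open>Tensor powers of the free module\<close>

text \<open>
  \<open>V\<^sub>n\<close> is free on \<open>x\<^sub>1, \<dots>, x\<^sub>n\<close>, so its \<open>q\<close>-th tensor power is free on the elements
  \<open>x\<^bsub>w 0\<^esub> \<otimes> \<dots> \<otimes> x\<^bsub>w (q-1)\<^esub>\<close>, for \<open>w\<close> ranging over the words of length \<open>q\<close> in \<open>{1..n}\<close>.
  A tensor is represented by its family of coefficients in this basis.
  Letters of the alphabet run from \<open>1\<close> to \<open>n\<close>; the \<open>q\<close> tensor factors are numbered from \<open>0\<close>.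
\<close>

definition words :: "nat \<Rightarrow> nat \<Rightarrow> nat list set" where
  "words n q = {w. length w = q \<and> set w \<subseteq> {1..n}}"

type_synonym 'k tensor = "nat list \<Rightarrow> 'k"

definition tensors :: "nat \<Rightarrow> nat \<Rightarrow> 'k::{comm_ring, comm_monoid_mult} tensor set" where
  "tensors n q = {v. \<forall>w. w \<notin> words n q \<longrightarrow> v w = 0}"

definition word_vec :: "nat list \<Rightarrow> 'k::{comm_ring, comm_monoid_mult} tensor" where
  "word_vec u = (\<lambda>w. if w = u then 1 else 0)"

text \<open>The product of a tensor of degree \<open>a\<close> with another tensor.\<close>

definition tens :: "nat \<Rightarrow> 'k::{comm_ring, comm_monoid_mult} tensor \<Rightarrow> 'k tensor \<Rightarrow> 'k tensor" where
  "tens a s t = (\<lambda>w. s (take a w) * t (drop a w))"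

text \<open>The action of \<open>\<sigma>\<close> on a tensor, in coordinates; see \<open>act_pure_tensor\<close> below.\<close>

definition act :: "(nat \<Rightarrow> nat) \<Rightarrow> 'k::{comm_ring, comm_monoid_mult} tensor \<Rightarrow> 'k tensor" where
  "act \<sigma> v = (\<lambda>w. v (permute_list \<sigma> w))"

text \<open>\<open>y\<^sub>0 \<otimes> \<dots> \<otimes> y\<^bsub>q-1\<^esub>\<close>, each \<open>y\<^sub>i\<close> in \<open>V\<^sub>n\<close> being given by its coordinates.\<close>

definition pure_tensor :: "(nat \<Rightarrow> 'k::{comm_ring, comm_monoid_mult}) list \<Rightarrow> 'k tensor" where
  "pure_tensor ys =
     (\<lambda>w. if length w = length ys then \<Prod>i<length ys. (ys ! i) (w ! i) else 0)"


section \<open>Schur algebras\<close>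

text \<open>Endomorphisms are functions on the carrier that are \<open>undefined\<close> outside of it, so that
  equality of functions is equality of endomorphisms.\<close>

definition tensor_endos ::
    "nat \<Rightarrow> nat \<Rightarrow> ('k::{comm_ring, comm_monoid_mult} tensor \<Rightarrow> 'k tensor) set" where
  "tensor_endos n q = {f \<in> tensors n q \<rightarrow>\<^sub>E tensors n q.
     (\<forall>v\<in>tensors n q. \<forall>w\<in>tensors n q. f (\<lambda>u. v u + w u) = (\<lambda>u. f v u + f w u)) \<and>
     (\<forall>c. \<forall>v\<in>tensors n q. f (\<lambda>u. c * v u) = (\<lambda>u. c * f v u))}"

definition schur_endos ::
    "nat \<Rightarrow> nat \<Rightarrow> ('k::{comm_ring, comm_monoid_mult} tensor \<Rightarrow> 'k tensor) set" where
  "schur_endos n q = {f \<in> tensor_endos n q.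
     \<forall>\<sigma>. \<sigma> permutes {..<q} \<longrightarrow> (\<forall>v\<in>tensors n q. f (act \<sigma> v) = act \<sigma> (f v))}"

text \<open>The convention \<open>Schur(0,n,K) = K\<close> is taken literally: in degree 0 the elements are
  the scalars.\<close>

datatype 'k schur = Scalar 'k | Endo "'k tensor \<Rightarrow> 'k tensor"

definition Schur :: "nat \<Rightarrow> nat \<Rightarrow> 'k::{comm_ring, comm_monoid_mult} schur set" where
  "Schur q n = (if q = 0 then range Scalar else Endo ` schur_endos n q)"

fun scale :: "nat \<Rightarrow> nat \<Rightarrow> 'k::{comm_ring, comm_monoid_mult} \<Rightarrow> 'k schur \<Rightarrow> 'k schur" where
  "scale n q c (Scalar d) = Scalar (c * d)"
| "scale n q c (Endo f) = Endo (\<lambda>v\<in>tensors n q. \<lambda>w. c * f v w)"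


section \<open>The inter-degree product\<close>

text \<open>The linear map \<open>f \<otimes> g\<close>, given by its values on the basis elements
  \<open>x\<^sub>u \<otimes> x\<^sub>w\<close>; see \<open>tensor_map_tens\<close> below.\<close>

definition tensor_map :: "nat \<Rightarrow> nat \<Rightarrow> nat \<Rightarrow>
    ('k::{comm_ring, comm_monoid_mult} tensor \<Rightarrow> 'k tensor) \<Rightarrow> ('k tensor \<Rightarrow> 'k tensor) \<Rightarrow>
    'k tensor \<Rightarrow> 'k tensor" where
  "tensor_map n a b f g = (\<lambda>v\<in>tensors n (a + b). \<lambda>z.
     \<Sum>u\<in>words n a. \<Sum>w\<in>words n b. v (u @ w) * tens a (f (word_vec u)) (g (word_vec w)) z)"

definition block_perm :: "nat \<Rightarrow> (nat \<Rightarrow> nat) \<Rightarrow> (nat \<Rightarrow> nat) \<Rightarrow> nat \<Rightarrow> nat" where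
  "block_perm a \<alpha> \<beta> = (\<lambda>i. if i < a then \<alpha> i else a + \<beta> (i - a))"

text \<open>The image of \<open>\<Sigma>\<^sub>a \<times> \<Sigma>\<^sub>b\<close> in \<open>\<Sigma>\<^bsub>a+b\<^esub>\<close>.\<close>

definition young :: "nat \<Rightarrow> nat \<Rightarrow> (nat \<Rightarrow> nat) set" where
  "young a b = {block_perm a \<alpha> \<beta> | \<alpha> \<beta>. \<alpha> permutes {..<a} \<and> \<beta> permutes {..<b}}"

text \<open>Complete sets of representatives of the left cosets \<open>\<tau>(\<Sigma>\<^sub>a \<times> \<Sigma>\<^sub>b)\<close>.\<close>

definition coset_reps :: "nat \<Rightarrow> nat \<Rightarrow> (nat \<Rightarrow> nat) set \<Rightarrow> bool" where
  "coset_reps a b L \<longleftrightarrow> L \<subseteq> {\<sigma>. \<sigma> permutes {..<a + b}} \<and>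
     (\<forall>\<sigma>. \<sigma> permutes {..<a + b} \<longrightarrow> (\<exists>!\<tau>. \<tau> \<in> L \<and> \<sigma> \<in> (\<lambda>\<rho>. \<tau> \<circ> \<rho>) ` young a b))"

definition box_over :: "nat \<Rightarrow> nat \<Rightarrow> nat \<Rightarrow> (nat \<Rightarrow> nat) set \<Rightarrow>
    ('k::{comm_ring, comm_monoid_mult} tensor \<Rightarrow> 'k tensor) \<Rightarrow> ('k tensor \<Rightarrow> 'k tensor) \<Rightarrow>
    'k tensor \<Rightarrow> 'k tensor" where
  "box_over n a b L f g = (\<lambda>v\<in>tensors n (a + b). \<lambda>z.
     \<Sum>\<sigma>\<in>L. act \<sigma> (tensor_map n a b f g (act (inv \<sigma>) v)) z)"

text \<open>Some set of representatives exists and the choice is immaterial; see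
  \<open>coset_reps_exists\<close> and \<open>box_over_cong\<close> below.\<close>

definition box_endo :: "nat \<Rightarrow> nat \<Rightarrow> nat \<Rightarrow>
    ('k::{comm_ring, comm_monoid_mult} tensor \<Rightarrow> 'k tensor) \<Rightarrow> ('k tensor \<Rightarrow> 'k tensor) \<Rightarrow>
    'k tensor \<Rightarrow> 'k tensor" where
  "box_endo n a b f g = box_over n a b (SOME L. coset_reps a b L) f g"

text \<open>The product \<open>\<boxtimes>\<close> of elements of degrees \<open>a\<close> and \<open>b\<close>.\<close>

fun box :: "nat \<Rightarrow> nat \<Rightarrow> nat \<Rightarrow>
    'k::{comm_ring, comm_monoid_mult} schur \<Rightarrow> 'k schur \<Rightarrow> 'k schur" where
  "box n a b (Scalar c) y = scale n b c y"
| "box n a b (Endo f) (Scalar c) = scale n a c (Endo f)"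
| "box n a b (Endo f) (Endo g) = Endo (box_endo n a b f g)"

text \<open>The left-nested product of \<open>x\<close>, of degree \<open>a\<close>, with a list of elements paired with their
  degrees.\<close>

primrec box_list :: "nat \<Rightarrow> nat \<Rightarrow>
    'k::{comm_ring, comm_monoid_mult} schur \<Rightarrow> (nat \<times> 'k schur) list \<Rightarrow> 'k schur" where
  "box_list n a x [] = x"
| "box_list n a x (p # ps) = box_list n (a + fst p) (box n a (fst p) x (snd p)) ps"


section \<open>Operads\<close>

text \<open>
  \<open>comp [k\<^sub>1, \<dots>, k\<^sub>m] \<theta> [\<theta>\<^sub>1, \<dots>, \<theta>\<^sub>m]\<close> is \<open>\<theta> \<circ> (\<theta>\<^sub>1, \<dots>, \<theta>\<^sub>m)\<close> for \<open>\<theta> \<in> P m\<close> and \<open>\<theta>\<^sub>i \<in> P k\<^sub>i\<close>. The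
  arities are passed explicitly because the sets \<open>P m\<close> need not be disjoint.
  The set \<open>P 0\<close> is not part of the structure.
\<close>

locale operad =
  fixes P :: "nat \<Rightarrow> 'x set"
    and unit :: 'x
    and comp :: "nat list \<Rightarrow> 'x \<Rightarrow> 'x list \<Rightarrow> 'x"
  assumes unit_closed: "unit \<in> P 1"
    and comp_closed:
      "\<lbrakk>ks \<noteq> []; \<forall>k\<in>set ks. 1 \<le> k; \<theta> \<in> P (length ks); list_all2 (\<lambda>\<phi> k. \<phi> \<in> P k) \<theta>s ks\<rbrakk>
       \<Longrightarrow> comp ks \<theta> \<theta>s \<in> P (sum_list ks)"
    and comp_unit_right:
      "\<lbrakk>1 \<le> m; \<theta> \<in> P m\<rbrakk> \<Longrightarrow> comp (replicate m 1) \<theta> (replicate m unit) = \<theta>"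
    and comp_unit_left:
      "\<lbrakk>1 \<le> m; \<theta> \<in> P m\<rbrakk> \<Longrightarrow> comp [m] unit [\<theta>] = \<theta>"
    and comp_assoc: \<comment> \<open>here \<open>kss ! i\<close> and \<open>\<theta>ss ! i\<close> list the arities and the elements
      \<open>\<theta>\<^bsub>i,1\<^esub>, \<theta>\<^bsub>i,2\<^esub>, \<dots>\<close> plugged into \<open>\<theta>s ! i\<close>\<close>
      "\<lbrakk>kss \<noteq> []; \<forall>ks\<in>set kss. ks \<noteq> [] \<and> (\<forall>k\<in>set ks. 1 \<le> k);
        \<theta> \<in> P (length kss);
        list_all2 (\<lambda>\<phi> ks. \<phi> \<in> P (length ks)) \<theta>s kss;
        list_all2 (list_all2 (\<lambda>\<psi> k. \<psi> \<in> P k)) \<theta>ss kss\<rbrakk>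
       \<Longrightarrow> comp (map sum_list kss) \<theta>
             (map (\<lambda>i. comp (kss ! i) (\<theta>s ! i) (\<theta>ss ! i)) [0..<length kss]) =
           comp (concat kss) (comp (map length kss) \<theta> \<theta>s) (concat \<theta>ss)"

definition schur_comp :: "nat \<Rightarrow> nat list \<Rightarrow>
    'k::{comm_ring, comm_monoid_mult} schur \<Rightarrow> 'k schur list \<Rightarrow> 'k schur" where
  "schur_comp n ks \<theta> \<theta>s = box_list n (length ks - 1) \<theta> (zip (map (\<lambda>k. k - 1) ks) \<theta>s)"


section \<open>The coordinate descriptions agree with the usual ones\<close>

lemma act_pure_tensor:
  assumes "\<sigma> permutes {..<length ys}"
  shows "act \<sigma> (pure_tensor ys) = pure_tensor (permute_list (inv \<sigma>) ys)"
proof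
  fix w :: "nat list"
  have inv: "inv \<sigma> permutes {..<length ys}" using assms by (rule permutes_inv)
  show "act \<sigma> (pure_tensor ys) w = pure_tensor (permute_list (inv \<sigma>) ys) w"
  proof (cases "length w = length ys")
    case True
    have "(\<Prod>i<length ys. (ys ! i) (permute_list \<sigma> w ! i)) = (\<Prod>i<length ys. (ys ! i) (w ! \<sigma> i))"
      by (intro prod.cong) (simp_all add: permute_list_nth assms True)
    also have "\<dots> = (\<Prod>i<length ys. (ys ! inv \<sigma> i) (w ! i))"
      using permutes_inverses[OF assms] permutes_in_image[OF assms] permutes_in_image[OF inv]
      by (intro prod.reindex_bij_witness[of _ "inv \<sigma>" \<sigma>]) auto
    also have "\<dots> = (\<Prod>i<length ys. (permute_list (inv \<sigma>) ys ! i) (w ! i))"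
      by (intro prod.cong) (simp_all add: permute_list_nth inv)
    finally show ?thesis by (simp add: act_def pure_tensor_def True)
  qed (simp add: act_def pure_tensor_def)
qed

lemma word_vec_eq_pure_tensor:
  "word_vec w = pure_tensor (map (\<lambda>j k. if k = j then 1 else 0) w)"
proof
  fix z :: "nat list"
  show "(word_vec w z :: 'k::{comm_ring, comm_monoid_mult}) =
      pure_tensor (map (\<lambda>j k. if k = j then 1 else 0) w) z"
  proof (cases "length z = length w \<and> z \<noteq> w")
    case True
    then obtain i where "i < length w" "z ! i \<noteq> w ! i"
      by (auto simp: list_eq_iff_nth_eq)
    then have "(\<Prod>i<length w. if z ! i = w ! i then 1 else 0 :: 'k) = 0"
      by (subst prod.remove[of _ i]) auto
    then show ?thesis using True by (auto simp: word_vec_def pure_tensor_def)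
  qed (auto simp: word_vec_def pure_tensor_def)
qed

lemma tens_pure_tensor:
  "tens (length xs) (pure_tensor xs) (pure_tensor ys) = pure_tensor (xs @ ys)"
proof
  fix w :: "nat list"
  show "tens (length xs) (pure_tensor xs) (pure_tensor ys) w = pure_tensor (xs @ ys) w"
  proof (cases "length w = length xs + length ys")
    case True
    have "(\<Prod>i<length xs + length ys. ((xs @ ys) ! i) (w ! i)) =
        (\<Prod>i<length xs. (xs ! i) (w ! i)) * (\<Prod>i<length ys. (ys ! i) (w ! (length xs + i)))"
    proof -
      have "(\<Prod>i<m + k. h i) = (\<Prod>i<m. h i) * (\<Prod>i<k. h (m + i))" for m k and h :: "nat \<Rightarrow> 'a"
        by (induction k) (simp_all add: mult.assoc)
      then show ?thesis by (simp add: nth_append)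
    qed
    then show ?thesis using True by (simp add: tens_def pure_tensor_def)
  qed (auto simp: tens_def pure_tensor_def)
qed

lemma finite_words [simp]: "finite (words n q)"
  using finite_lists_length_eq[of "{1..n}" q] by (simp add: words_def conj_commute)

lemma word_vec_in_tensors: "u \<in> words n q \<Longrightarrow> word_vec u \<in> tensors n q"
  by (auto simp: tensors_def word_vec_def)

lemma endo_add:
  "\<lbrakk>f \<in> tensor_endos n q; v \<in> tensors n q; w \<in> tensors n q\<rbrakk>
   \<Longrightarrow> f (\<lambda>u. v u + w u) = (\<lambda>u. f v u + f w u)"
  by (simp add: tensor_endos_def)

lemma endo_scale:
  "\<lbrakk>f \<in> tensor_endos n q; v \<in> tensors n q\<rbrakk> \<Longrightarrow> f (\<lambda>u. c * v u) = (\<lambda>u. c * f v u)"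
  by (simp add: tensor_endos_def)

lemma endo_expand:
  assumes f: "f \<in> tensor_endos n q" and v: "v \<in> tensors n q"
  shows "f v z = (\<Sum>u\<in>words n q. v u * f (word_vec u) z)"
proof -
  have zero: "f (\<lambda>_. 0) = (\<lambda>_. 0)"
  proof -
    have "(\<lambda>_. 0) \<in> (tensors n q :: 'a tensor set)" by (simp add: tensors_def)
    from endo_scale[OF f this, of 0] show ?thesis by simp
  qed
  have sub: "f (\<lambda>z. \<Sum>u\<in>A. v u * word_vec u z) = (\<lambda>z. \<Sum>u\<in>A. v u * f (word_vec u) z)"
    if "finite A" "A \<subseteq> words n q" for A
    using that
  proof (induction A)
    case empty
    then show ?case by (simp add: zero)
  next
    case (insert x A)
    have 1: "(word_vec x :: 'a tensor) \<in> tensors n q" using insert.prems by (simp add: word_vec_in_tensors)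
    then have 2: "(\<lambda>z. v x * word_vec x z) \<in> tensors n q" by (simp add: tensors_def)
    have "(\<Sum>u\<in>A. v u * word_vec u z) = 0" if "z \<notin> words n q" for z
      using insert.prems that by (intro sum.neutral) (auto simp: word_vec_def)
    then have 3: "(\<lambda>z. \<Sum>u\<in>A. v u * word_vec u z) \<in> tensors n q"
      unfolding tensors_def by blast
    have "f (\<lambda>z. v x * word_vec x z + (\<Sum>u\<in>A. v u * word_vec u z)) =
        (\<lambda>z. f (\<lambda>z. v x * word_vec x z) z + f (\<lambda>z. \<Sum>u\<in>A. v u * word_vec u z) z)"
      by (rule endo_add[OF f 2 3])
    also have "f (\<lambda>z. v x * word_vec x z) = (\<lambda>z. v x * f (word_vec x) z)"
      by (rule endo_scale[OF f 1])
    finally show ?case using insert by simp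
  qed
  have "(\<lambda>z. \<Sum>u\<in>words n q. v u * word_vec u z) = v"
  proof
    fix z
    have "(\<Sum>u\<in>words n q. v u * word_vec u z) = (\<Sum>u\<in>words n q. if u = z then v z else 0)"
      by (intro sum.cong) (auto simp: word_vec_def)
    also have "\<dots> = v z" using v by (auto simp: tensors_def)
    finally show "(\<Sum>u\<in>words n q. v u * word_vec u z) = v z" .
  qed
  with sub[OF finite_words order_refl] show ?thesis by simp
qed

lemma tens_in_tensors:
  assumes "s \<in> tensors n a" "t \<in> tensors n b"
  shows "tens a s t \<in> tensors n (a + b)"
proof -
  have "tens a s t w = 0" if "w \<notin> words n (a + b)" for w
  proof -
    have "take a w \<notin> words n a \<or> drop a w \<notin> words n b"
      using that set_append[of "take a w" "drop a w"] by (auto simp: words_def)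
    then show ?thesis using assms by (auto simp: tens_def tensors_def)
  qed
  then show ?thesis by (simp add: tensors_def)
qed

lemma tensor_map_tens:
  assumes "f \<in> tensor_endos n a" "g \<in> tensor_endos n b" "s \<in> tensors n a" "t \<in> tensors n b"
  shows "tensor_map n a b f g (tens a s t) = tens a (f s) (g t)"
proof
  fix z
  have "tensor_map n a b f g (tens a s t) z = (\<Sum>u\<in>words n a. \<Sum>w\<in>words n b.
      (s u * f (word_vec u) (take a z)) * (t w * g (word_vec w) (drop a z)))"
    using tens_in_tensors[OF assms(3,4)]
    by (auto simp: tensor_map_def tens_def words_def mult_ac intro!: sum.cong)
  also have "\<dots> = f s (take a z) * g t (drop a z)"
    by (simp add: endo_expand[OF assms(1,3)] endo_expand[OF assms(2,4)] sum_product)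
  finally show "tensor_map n a b f g (tens a s t) z = tens a (f s) (g t) z"
    by (simp add: tens_def)
qed

lemma tensor_map_linear:
  assumes f: "f \<in> tensor_endos n a" and g: "g \<in> tensor_endos n b"
  shows "tensor_map n a b f g \<in> tensor_endos n (a + b)"
proof -
  have "tensor_map n a b f g v \<in> tensors n (a + b)" if "v \<in> tensors n (a + b)" for v
  proof -
    have "tens a (f (word_vec u)) (g (word_vec w)) \<in> tensors n (a + b)"
      if "u \<in> words n a" "w \<in> words n b" for u w
      using f g that
      by (intro tens_in_tensors) (auto simp: tensor_endos_def word_vec_in_tensors)
    then have "tens a (f (word_vec u)) (g (word_vec w)) z = 0"
      if "u \<in> words n a" "w \<in> words n b" "z \<notin> words n (a + b)" for u w z
      using that unfolding tensors_def by blast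
    then show ?thesis
      using that by (auto simp: tensor_map_def tensors_def)
  qed
  moreover have "(\<lambda>u. v u + w u) \<in> tensors n (a + b)"
    if "v \<in> tensors n (a + b)" "w \<in> tensors n (a + b)" for v w :: "'a tensor"
    using that by (simp add: tensors_def)
  moreover have "(\<lambda>u. c * v u) \<in> tensors n (a + b)"
    if "v \<in> tensors n (a + b)" for v :: "'a tensor" and c
    using that by (simp add: tensors_def)
  ultimately show ?thesis
    by (auto simp: tensor_endos_def tensor_map_def fun_eq_iff distrib_right sum.distrib
        sum_distrib_left mult.assoc)
qed


section \<open>Independence of the choice of representatives\<close>

lemma act_in_tensors:
  assumes "\<sigma> permutes {..<q}" "v \<in> tensors n q"
  shows "act \<sigma> v \<in> tensors n q"
  using assms by (auto simp: tensors_def act_def words_def)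

lemma act_act:
  assumes "\<tau> permutes {..<q}" "v \<in> tensors n q"
  shows "act \<sigma> (act \<tau> v) = act (\<sigma> \<circ> \<tau>) v"
proof
  fix w
  show "act \<sigma> (act \<tau> v) w = act (\<sigma> \<circ> \<tau>) v w"
    using assms by (cases "length w = q")
      (auto simp: act_def permute_list_compose tensors_def words_def)
qed

lemma block_perm_permutes:
  assumes "\<alpha> permutes {..<a}" "\<beta> permutes {..<b}"
  shows "block_perm a \<alpha> \<beta> permutes {..<a + b}"
proof (rule bij_imp_permutes)
  have A: "\<alpha> i < a \<longleftrightarrow> i < a" "inv \<alpha> i < a \<longleftrightarrow> i < a" "\<beta> j < b \<longleftrightarrow> j < b" "inv \<beta> j < b \<longleftrightarrow> j < b" for i j
    using permutes_in_image[OF assms(1)] permutes_in_image[OF assms(2)]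
      permutes_in_image[OF permutes_inv[OF assms(1)]] permutes_in_image[OF permutes_inv[OF assms(2)]]
    by auto
  have B: "i < a + b \<longleftrightarrow> i - a < b" if "\<not> i < a" for i using that by auto
  show "bij_betw (block_perm a \<alpha> \<beta>) {..<a + b} {..<a + b}"
    by (rule bij_betw_byWitness[of _ "block_perm a (inv \<alpha>) (inv \<beta>)"])
      (auto simp: block_perm_def A B permutes_inverses[OF assms(1)] permutes_inverses[OF assms(2)]
        intro: trans_less_add1)
  show "block_perm a \<alpha> \<beta> x = x" if "x \<notin> {..<a + b}" for x
    using that permutes_not_in[OF assms(2), of "x - a"] by (auto simp: block_perm_def)
qed

lemma block_perm_comp:
  assumes "\<alpha>' permutes {..<a}"
  shows "block_perm a \<alpha> \<beta> \<circ> block_perm a \<alpha>' \<beta>' = block_perm a (\<alpha> \<circ> \<alpha>') (\<beta> \<circ> \<beta>')"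
  using permutes_in_image[OF assms] by (auto simp: block_perm_def fun_eq_iff)

lemma block_perm_id: "block_perm a id id = id"
  by (auto simp: block_perm_def fun_eq_iff)

lemma young_permutes: "\<rho> \<in> young a b \<Longrightarrow> \<rho> permutes {..<a + b}"
  by (auto simp: young_def block_perm_permutes)

lemma young_comp: "\<rho> \<in> young a b \<Longrightarrow> \<rho>' \<in> young a b \<Longrightarrow> \<rho> \<circ> \<rho>' \<in> young a b"
  unfolding young_def using block_perm_comp permutes_compose by blast

lemma young_id: "id \<in> young a b"
  unfolding young_def using block_perm_id[of a, symmetric] permutes_id by blast

lemma young_inv:
  assumes "\<rho> \<in> young a b"
  shows "inv \<rho> \<in> young a b"
proof -
  obtain \<alpha> \<beta> where *: "\<rho> = block_perm a \<alpha> \<beta>" "\<alpha> permutes {..<a}" "\<beta> permutes {..<b}"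
    using assms by (auto simp: young_def)
  have "block_perm a (inv \<alpha>) (inv \<beta>) \<circ> \<rho> = id"
    using * block_perm_comp[OF *(2), of "inv \<alpha>" "inv \<beta>" \<beta>] by (simp add: permutes_inv_o block_perm_id)
  then have "inv \<rho> = block_perm a (inv \<alpha>) (inv \<beta>)"
    by (metis assms young_permutes comp_assoc comp_id id_comp permutes_inv_o(1))
  then show ?thesis using *(2,3) permutes_inv unfolding young_def by blast
qed

lemma coset_reps_exists: "\<exists>L. coset_reps a b L"
proof -
  define r where "r \<sigma> = (SOME \<tau>. \<tau> \<in> (\<lambda>\<rho>. \<sigma> \<circ> \<rho>) ` young a b)"
    for \<sigma> :: "nat \<Rightarrow> nat"
  have self: "\<sigma> \<in> (\<lambda>\<rho>. \<sigma> \<circ> \<rho>) ` young a b" for \<sigma> :: "nat \<Rightarrow> nat"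
    by (rule image_eqI[OF _ young_id]) simp
  have r: "r \<sigma> \<in> (\<lambda>\<rho>. \<sigma> \<circ> \<rho>) ` young a b" for \<sigma>
    unfolding r_def
    by (rule someI[where P = "\<lambda>\<tau>. \<tau> \<in> (\<lambda>\<rho>. \<sigma> \<circ> \<rho>) ` young a b"]) (rule self)
  have coset: "(\<lambda>\<rho>. (\<sigma> \<circ> \<rho>') \<circ> \<rho>) ` young a b = (\<lambda>\<rho>. \<sigma> \<circ> \<rho>) ` young a b"
    if "\<rho>' \<in> young a b" for \<sigma> \<rho>' :: "nat \<Rightarrow> nat"
  proof -
    have "\<rho> \<in> (\<lambda>\<rho>. \<rho>' \<circ> \<rho>) ` young a b" if "\<rho> \<in> young a b" for \<rho>
    proof
      show "\<rho> = \<rho>' \<circ> (inv \<rho>' \<circ> \<rho>)"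
        using permutes_inv_o(1)[OF young_permutes[OF \<open>\<rho>' \<in> young a b\<close>]]
        by (simp add: o_assoc)
      show "inv \<rho>' \<circ> \<rho> \<in> young a b" using that \<open>\<rho>' \<in> young a b\<close> by (simp add: young_comp young_inv)
    qed
    then have "(\<lambda>\<rho>. \<rho>' \<circ> \<rho>) ` young a b = young a b"
      using young_comp[OF \<open>\<rho>' \<in> young a b\<close>] by blast
    then show ?thesis by (metis (no_types, lifting) comp_assoc image_cong image_image)
  qed
  have r_eq: "r (\<sigma> \<circ> \<rho>) = r \<sigma>" if "\<rho> \<in> young a b" for \<sigma> \<rho>
    unfolding r_def coset[OF that] ..
  have perm: "r \<sigma> permutes {..<a + b}" if "\<sigma> permutes {..<a + b}" for \<sigma>
  proof -
    obtain \<rho> where "\<rho> \<in> young a b" "r \<sigma> = \<sigma> \<circ> \<rho>" using r[of \<sigma>] by (rule imageE)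
    then show ?thesis using that by (simp add: permutes_compose young_permutes)
  qed
  have mem: "\<sigma> \<in> (\<lambda>\<rho>. r \<sigma> \<circ> \<rho>) ` young a b" for \<sigma>
  proof -
    obtain \<rho> where \<rho>: "\<rho> \<in> young a b" "r \<sigma> = \<sigma> \<circ> \<rho>" using r[of \<sigma>] by (rule imageE)
    then show ?thesis using self[of \<sigma>] coset[OF \<rho>(1), of \<sigma>] by simp
  qed
  have "coset_reps a b (r ` {\<sigma>. \<sigma> permutes {..<a + b}})"
    unfolding coset_reps_def
  proof (intro conjI allI impI)
    show "r ` {\<sigma>. \<sigma> permutes {..<a + b}} \<subseteq> {\<sigma>. \<sigma> permutes {..<a + b}}" using perm by blast
    fix \<sigma> :: "nat \<Rightarrow> nat" assume \<sigma>: "\<sigma> permutes {..<a + b}"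
    show "\<exists>!\<tau>. \<tau> \<in> r ` {\<sigma>. \<sigma> permutes {..<a + b}} \<and> \<sigma> \<in> (\<lambda>\<rho>. \<tau> \<circ> \<rho>) ` young a b"
    proof (rule ex1I[of _ "r \<sigma>"])
      show "r \<sigma> \<in> r ` {\<sigma>. \<sigma> permutes {..<a + b}} \<and> \<sigma> \<in> (\<lambda>\<rho>. r \<sigma> \<circ> \<rho>) ` young a b"
        using \<sigma> mem[of \<sigma>] by simp
      fix \<tau> assume *: "\<tau> \<in> r ` {\<sigma>. \<sigma> permutes {..<a + b}} \<and> \<sigma> \<in> (\<lambda>\<rho>. \<tau> \<circ> \<rho>) ` young a b"
      then obtain \<sigma>' where "\<tau> = r \<sigma>'" by blast
      moreover obtain \<rho> where "\<rho> \<in> young a b" "\<sigma> = \<tau> \<circ> \<rho>" using conjunct2[OF *] by (rule imageE)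
      moreover obtain \<rho>' where "\<rho>' \<in> young a b" "r \<sigma>' = \<sigma>' \<circ> \<rho>'" using r by (rule imageE)
      ultimately show "\<tau> = r \<sigma>" by (simp add: r_eq)
    qed
  qed
  then show ?thesis by blast
qed

lemma permute_list_block_perm:
  assumes "\<alpha> permutes {..<a}" "\<beta> permutes {..<b}" "length z = a + b"
  shows "permute_list (block_perm a \<alpha> \<beta>) z = permute_list \<alpha> (take a z) @ permute_list \<beta> (drop a z)"
proof (rule nth_equalityI)
  fix i assume "i < length (permute_list (block_perm a \<alpha> \<beta>) z)"
  then have i: "i < a + b" using assms by simp
  have "\<alpha> i < a \<longleftrightarrow> i < a" "\<beta> (i - a) < b \<longleftrightarrow> i - a < b"
    using permutes_in_image[OF assms(1), of i] permutes_in_image[OF assms(2), of "i - a"] by auto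
  then show "permute_list (block_perm a \<alpha> \<beta>) z ! i =
      (permute_list \<alpha> (take a z) @ permute_list \<beta> (drop a z)) ! i"
    using i assms(3) by (auto simp: permute_list_def nth_append block_perm_def)
qed (use assms in simp)

lemma act_word_vec:
  assumes "\<alpha> permutes {..<length u}"
  shows "act \<alpha> (word_vec (permute_list \<alpha> u)) = word_vec u"
proof -
  have "permute_list \<alpha> w = permute_list \<alpha> u \<longleftrightarrow> w = u" for w
  proof
    assume *: "permute_list \<alpha> w = permute_list \<alpha> u"
    then have len: "length w = length u" by (metis length_permute_list)
    have "permute_list (inv \<alpha>) (permute_list \<alpha> x) = x" if "length x = length u" for x :: "nat list"
      using permute_list_compose[of "inv \<alpha>" x \<alpha>] permutes_inv[OF assms] permutes_inv_o(1)[OF assms] that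
      by simp
    then show "w = u" using * len by metis
  qed simp
  then show ?thesis by (simp add: act_def word_vec_def)
qed

lemma sum_words_permute:
  assumes "\<alpha> permutes {..<a}"
  shows "(\<Sum>u\<in>words n a. h (permute_list \<alpha> u)) = (\<Sum>u\<in>words n a. h u)"
proof -
  have inv: "inv \<alpha> permutes {..<a}" using assms by (rule permutes_inv)
  have 1: "permute_list \<alpha> (permute_list (inv \<alpha>) x) = x" if "length x = a" for x :: "nat list"
    using permute_list_compose[of \<alpha> x "inv \<alpha>"] permutes_inv_o(2)[OF assms] that assms by simp
  have 2: "permute_list (inv \<alpha>) (permute_list \<alpha> x) = x" if "length x = a" for x :: "nat list"
    using permute_list_compose[of "inv \<alpha>" x \<alpha>] permutes_inv_o(1)[OF assms] that inv by simp
  show ?thesis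
    by (rule sum.reindex_bij_witness[of _ "permute_list (inv \<alpha>)" "permute_list \<alpha>"])
      (use assms inv 1 2 in \<open>auto simp: words_def\<close>)
qed

lemma schur_endo_act:
  "\<lbrakk>f \<in> schur_endos n q; \<sigma> permutes {..<q}; v \<in> tensors n q\<rbrakk> \<Longrightarrow> f (act \<sigma> v) = act \<sigma> (f v)"
  unfolding schur_endos_def by blast

lemma tensor_map_act_young:
  assumes f: "f \<in> schur_endos n a" and g: "g \<in> schur_endos n b"
    and \<rho>: "\<rho> \<in> young a b" and v: "v \<in> tensors n (a + b)"
  shows "tensor_map n a b f g (act \<rho> v) = act \<rho> (tensor_map n a b f g v)"
proof
  fix z
  obtain \<alpha> \<beta> where eq: "\<rho> = block_perm a \<alpha> \<beta>" and \<alpha>: "\<alpha> permutes {..<a}" and \<beta>: "\<beta> permutes {..<b}"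
    using \<rho> by (auto simp: young_def)
  have perm: "\<rho> permutes {..<a + b}" using \<rho> by (rule young_permutes)
  have lin: "tensor_map n a b f g \<in> tensor_endos n (a + b)"
    using f g by (intro tensor_map_linear) (auto simp: schur_endos_def)
  have in1: "act \<rho> v \<in> tensors n (a + b)" using perm v by (rule act_in_tensors)
  show "tensor_map n a b f g (act \<rho> v) z = act \<rho> (tensor_map n a b f g v) z"
  proof (cases "length z = a + b")
    case False
    have "tensor_map n a b f g (act \<rho> v) \<in> tensors n (a + b)"
      "act \<rho> (tensor_map n a b f g v) \<in> tensors n (a + b)"
      using lin in1 v perm by (auto simp: tensor_endos_def intro!: act_in_tensors)
    then show ?thesis using False by (auto simp: tensors_def words_def)
  next
    case True
    have F: "f (word_vec u) (take a z) = f (word_vec (permute_list \<alpha> u)) (permute_list \<alpha> (take a z))"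
      if "u \<in> words n a" for u
    proof -
      have u: "permute_list \<alpha> u \<in> words n a" using that \<alpha> by (auto simp: words_def)
      have "f (word_vec u) = f (act \<alpha> (word_vec (permute_list \<alpha> u)))"
        using that \<alpha> by (simp add: act_word_vec words_def)
      also have "\<dots> = act \<alpha> (f (word_vec (permute_list \<alpha> u)))"
        by (rule schur_endo_act[OF f \<alpha> word_vec_in_tensors[OF u]])
      finally show ?thesis by (simp add: act_def)
    qed
    have G: "g (word_vec u) (drop a z) = g (word_vec (permute_list \<beta> u)) (permute_list \<beta> (drop a z))"
      if "u \<in> words n b" for u
    proof -
      have u: "permute_list \<beta> u \<in> words n b" using that \<beta> by (auto simp: words_def)
      have "g (word_vec u) = g (act \<beta> (word_vec (permute_list \<beta> u)))"
        using that \<beta> by (simp add: act_word_vec words_def)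
      also have "\<dots> = act \<beta> (g (word_vec (permute_list \<beta> u)))"
        by (rule schur_endo_act[OF g \<beta> word_vec_in_tensors[OF u]])
      finally show ?thesis by (simp add: act_def)
    qed
    have H: "act \<rho> v (u @ w) = v (permute_list \<alpha> u @ permute_list \<beta> w)"
      if "u \<in> words n a" "w \<in> words n b" for u w
      using permute_list_block_perm[OF \<alpha> \<beta>, of "u @ w"] that by (simp add: act_def eq words_def)
    define h where "h u w = v (u @ w) * (f (word_vec u) (permute_list \<alpha> (take a z)) *
        g (word_vec w) (permute_list \<beta> (drop a z)))" for u w
    have "tensor_map n a b f g (act \<rho> v) z =
        (\<Sum>u\<in>words n a. \<Sum>w\<in>words n b. h (permute_list \<alpha> u) (permute_list \<beta> w))"
      using in1 by (simp add: tensor_map_def tens_def h_def F G H)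
    also have "\<dots> = (\<Sum>u\<in>words n a. \<Sum>w\<in>words n b. h (permute_list \<alpha> u) w)"
      by (intro sum.cong refl sum_words_permute[OF \<beta>])
    also have "\<dots> = (\<Sum>u\<in>words n a. \<Sum>w\<in>words n b. h u w)"
      by (rule sum_words_permute[OF \<alpha>, of "\<lambda>u. \<Sum>w\<in>words n b. h u w"])
    also have "\<dots> = act \<rho> (tensor_map n a b f g v) z"
      using v permute_list_block_perm[OF \<alpha> \<beta> True] True
      by (simp add: act_def tensor_map_def tens_def h_def eq)
    finally show ?thesis .
  qed
qed

lemma box_over_cong:
  assumes f: "f \<in> schur_endos n a" and g: "g \<in> schur_endos n b"
    and L: "coset_reps a b L" and L': "coset_reps a b L'"
  shows "box_over n a b L f g = box_over n a b L' f g"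
proof -
  define r where "r M \<sigma> = (THE \<tau>. \<tau> \<in> M \<and> \<sigma> \<in> (\<lambda>\<rho>. \<tau> \<circ> \<rho>) ` young a b)"
    for M :: "(nat \<Rightarrow> nat) set" and \<sigma>
  have ex1: "\<exists>!\<tau>. \<tau> \<in> M \<and> \<sigma> \<in> (\<lambda>\<rho>. \<tau> \<circ> \<rho>) ` young a b"
    if "coset_reps a b M" "\<sigma> permutes {..<a + b}" for M \<sigma>
    using that(1)[unfolded coset_reps_def, THEN conjunct2, rule_format, OF that(2)] .
  have r: "r M \<sigma> \<in> M \<and> \<sigma> \<in> (\<lambda>\<rho>. r M \<sigma> \<circ> \<rho>) ` young a b"
    if "coset_reps a b M" "\<sigma> permutes {..<a + b}" for M \<sigma>
    unfolding r_def by (rule theI'[OF ex1[OF that]])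
  have r_unique: "r M \<sigma> = \<tau>"
    if "coset_reps a b M" "\<sigma> permutes {..<a + b}" "\<tau> \<in> M" "\<sigma> \<in> (\<lambda>\<rho>. \<tau> \<circ> \<rho>) ` young a b" for M \<sigma> \<tau>
    unfolding r_def by (rule the1_equality[OF ex1[OF that(1,2)]]) (rule conjI[OF that(3,4)])
  have perm: "\<sigma> permutes {..<a + b}" if "coset_reps a b M" "\<sigma> \<in> M" for M \<sigma>
    using that by (auto simp: coset_reps_def)
  have r_r: "r M (r M' \<sigma>) = \<sigma>" if M: "coset_reps a b M" "coset_reps a b M'" "\<sigma> \<in> M" for M M' \<sigma>
  proof -
    note \<sigma> = perm[OF M(1,3)]
    obtain \<rho> where \<rho>: "\<rho> \<in> young a b" "\<sigma> = r M' \<sigma> \<circ> \<rho>"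
      using conjunct2[OF r[OF M(2) \<sigma>]] by (rule imageE)
    have "\<sigma> \<circ> inv \<rho> = r M' \<sigma> \<circ> (\<rho> \<circ> inv \<rho>)" using \<rho>(2) by (metis comp_assoc)
    then have "r M' \<sigma> = \<sigma> \<circ> inv \<rho>"
      using permutes_inv_o(1)[OF young_permutes[OF \<rho>(1)]] by simp
    then have "r M' \<sigma> \<in> (\<lambda>\<rho>. \<sigma> \<circ> \<rho>) ` young a b" using young_inv[OF \<rho>(1)] by (rule image_eqI)
    with r_unique[OF M(1) perm[OF M(2) conjunct1[OF r[OF M(2) \<sigma>]]] M(3)] show ?thesis .
  qed
  have lin: "tensor_map n a b f g \<in> tensor_endos n (a + b)"
    using f g by (intro tensor_map_linear) (auto simp: schur_endos_def)
  have summand: "act (r L' \<sigma>) (tensor_map n a b f g (act (inv (r L' \<sigma>)) v)) =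
      act \<sigma> (tensor_map n a b f g (act (inv \<sigma>) v))"
    if "\<sigma> \<in> L" and v: "v \<in> tensors n (a + b)" for \<sigma> v
  proof -
    note \<sigma> = perm[OF L that(1)]
    define \<tau> where "\<tau> = r L' \<sigma>"
    obtain \<rho> where \<rho>: "\<rho> \<in> young a b" "\<sigma> = \<tau> \<circ> \<rho>"
      using conjunct2[OF r[OF L' \<sigma>]] unfolding \<tau>_def by (rule imageE)
    have \<tau>: "\<tau> permutes {..<a + b}" unfolding \<tau>_def using conjunct1[OF r[OF L' \<sigma>]] by (rule perm[OF L'])
    have \<rho>p: "\<rho> permutes {..<a + b}" using \<rho>(1) by (rule young_permutes)
    have "inv \<tau> = \<rho> \<circ> inv \<sigma>"
      unfolding \<rho>(2) using permutes_inv_o(1)[OF \<rho>p] permutes_bij[OF \<tau>] permutes_bij[OF \<rho>p]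
      by (simp add: o_inv_distrib bij_is_inj bij_is_surj o_assoc)
    then have "act (inv \<tau>) v = act \<rho> (act (inv \<sigma>) v)"
      using act_act[OF permutes_inv[OF \<sigma>] v] by simp
    moreover have w: "act (inv \<sigma>) v \<in> tensors n (a + b)"
      using permutes_inv[OF \<sigma>] v by (rule act_in_tensors)
    moreover have "tensor_map n a b f g (act (inv \<sigma>) v) \<in> tensors n (a + b)"
      using lin w by (auto simp: tensor_endos_def)
    ultimately show ?thesis
      unfolding \<tau>_def[symmetric] using tensor_map_act_young[OF f g \<rho>(1) w] act_act[OF \<rho>p] \<rho>(2) by simp
  qed
  have "(\<Sum>\<sigma>\<in>L. act \<sigma> (tensor_map n a b f g (act (inv \<sigma>) v)) z) =
      (\<Sum>\<sigma>\<in>L'. act \<sigma> (tensor_map n a b f g (act (inv \<sigma>) v)) z)"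
    if "v \<in> tensors n (a + b)" for v z
    by (rule sum.reindex_bij_witness[of _ "r L" "r L'"])
      (use r_r[OF L L'] r_r[OF L' L] conjunct1[OF r[OF L]] conjunct1[OF r[OF L']] perm[OF L]
          perm[OF L'] summand that in simp_all)
  then show ?thesis by (auto simp: box_over_def fun_eq_iff)
qed

lemma box_endo_eq:
  assumes "f \<in> schur_endos n a" "g \<in> schur_endos n b" "coset_reps a b L"
  shows "box_endo n a b f g = box_over n a b L f g"
  unfolding box_endo_def
  using assms(1,2) someI_ex[OF coset_reps_exists] assms(3) by (rule box_over_cong)

end

theory Submission
  imports Defs
begin

text \<open>
  The product \<open>\<boxtimes>\<close> is associative, commutative and unital, and the operad axioms follow: both sides
  of the associativity axiom are products of the same factors. To see this, encode an element of
  degree \<open>q\<close> by its matrix coefficients, as a function on lists of \<open>q\<close> pairs (row letter, column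
  letter). Evaluated with the order-preserving coset representatives, the product becomes
  \<open>(F \<star> G) p = (\<Sum>S. F (p restricted to S) * G (p restricted to the complement of S))\<close>,
  a convolution for which the monoid laws are immediate inductions on \<open>p\<close>. Functions on lists of all
  lengths form one monoid under \<open>\<star>\<close>, so no bookkeeping of degrees is needed, and a scalar of degree 0
  is a function supported on the empty list.
\<close>

section \<open>Shuffle convolution\<close>

text \<open>This is the shuffle product of formal series in noncommuting letters, a list being a
  monomial and the function value its coefficient. Stripping the leading letter is a derivation of
  that product, and this Leibniz rule serves as the recursion.\<close>

fun conv :: "('x list \<Rightarrow> 'k) \<Rightarrow> ('x list \<Rightarrow> 'k) \<Rightarrow> 'x list \<Rightarrow> 'k::{comm_ring, comm_monoid_mult}" where
  "conv F G [] = F [] * G []"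
| "conv F G (x # p) = conv (\<lambda>l. F (x # l)) G p + conv F (\<lambda>l. G (x # l)) p"


definition conv_unit :: "'x list \<Rightarrow> 'k::{comm_ring, comm_monoid_mult}" where
  "conv_unit p = (if p = [] then 1 else 0)"

section \<open>Biadditivity and the commutative monoid laws\<close>

lemma conv_add_left: "conv (\<lambda>l. F l + F' l) G p = conv F G p + conv F' G p"
  by (induction p arbitrary: F F' G) (simp_all add: distrib_right add_ac)

lemma conv_commute: "conv F G p = conv G F p"
  by (induction p arbitrary: F G) (simp_all add: mult_ac add_ac)

lemma conv_add_right: "conv F (\<lambda>l. G l + G' l) p = conv F G p + conv F G' p"
  by (simp add: conv_commute[of F] conv_add_left)

text \<open>By the Leibniz rule and additivity both sides split into the same three terms, the
  leading letter going to \<open>F\<close>, \<open>G\<close> or \<open>H\<close>; the induction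
  hypothesis matches them one by one.\<close>

lemma conv_assoc: "conv (conv F G) H p = conv F (conv G H) p"
proof (induction p arbitrary: F G H)
  case (Cons x p)
  then show ?case by (simp add: conv_add_left conv_add_right add_ac)
qed (simp add: mult_ac)

lemma conv_zero_left: "conv (\<lambda>l. 0) G p = 0"
  by (induction p arbitrary: G) simp_all

text \<open>A function supported on \<open>[]\<close> vanishes as soon as it receives a letter, so
  every letter goes to \<open>G\<close>. This accounts for the products with a factor of degree
  0.\<close>

lemma conv_scale_unit: "conv (\<lambda>p. if p = [] then c else 0) G p = c * G p"
  by (induction p arbitrary: G) (simp_all add: conv_zero_left)

interpretation conv: comm_monoid_list conv conv_unit
proof
  show left: "conv conv_unit F = F" for F :: "'x list \<Rightarrow> 'k::{comm_ring, comm_monoid_mult}"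
    by (rule ext) (simp add: conv_unit_def[abs_def] conv_scale_unit)
  show "conv F conv_unit = F" for F :: "'x list \<Rightarrow> 'k::{comm_ring, comm_monoid_mult}"
    by (rule trans[OF _ left]) (rule ext, rule conv_commute)
qed (rule ext, rule conv_assoc conv_commute)+

abbreviation conv_list where "conv_list \<equiv> conv.F"

text \<open>Here commutativity enters the associativity law of the operad: it separates the product
  of all \<theta>_i from the products of the elements plugged into them.\<close>

lemma conv_list_map_conv:
  "conv_list (map (\<lambda>i. conv (f i) (g i)) is) = conv (conv_list (map f is)) (conv_list (map g is))"
  by (induction "is") (simp_all add: conv.left_commute conv.assoc)

lemma conv_list_concat: "conv_list (concat Fss) = conv_list (map conv_list Fss)"
  by (induction Fss) simp_all

lemma conv_list_replicate_unit: "conv_list (replicate m conv_unit) = conv_unit"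
  by (induction m) simp_all

section \<open>Expansion over subsets of positions, and supports\<close>

lemma conv_eq_sum_nths:
  "conv F G p = (\<Sum>S\<in>Pow {..<length p}. F (nths p S) * G (nths p (- S)))"
proof (induction p arbitrary: F G)
  case (Cons x p)
  let ?h = "\<lambda>S. F (nths (x # p) S) * G (nths (x # p) (- S))"
  \<comment> \<open>Subsets are sorted by whether they contain position 0, that is, by whether the
    letter \<open>x\<close> goes to \<open>F\<close> or to \<open>G\<close>. These are the two terms
    of the recursion, and the remaining positions are shifted by \<open>Suc\<close>.\<close>
  have pow: "Pow {..<length (x # p)} = (`) Suc ` Pow {..<length p} \<union> insert 0 ` (`) Suc ` Pow {..<length p}"
    by (simp add: lessThan_Suc_eq_insert_0 Pow_insert image_Pow_surj[OF refl])
  have inj1: "inj_on ((`) Suc) (Pow {..<length p})"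
    by (simp add: inj_on_def inj_image_eq_iff)
  have inj2: "inj_on (insert 0) ((`) Suc ` Pow {..<length p})"
    by (auto simp: inj_on_def)
  have "sum ?h (Pow {..<length (x # p)}) =
      sum ?h ((`) Suc ` Pow {..<length p}) + sum ?h (insert 0 ` (`) Suc ` Pow {..<length p})"
    unfolding pow by (rule sum.union_disjoint) auto
  also have "\<dots> = (\<Sum>S\<in>Pow {..<length p}. ?h (Suc ` S)) + (\<Sum>S\<in>Pow {..<length p}. ?h (insert 0 (Suc ` S)))"
    by (simp add: sum.reindex[OF inj1] sum.reindex[OF inj2] o_def)
  also have "(\<Sum>S\<in>Pow {..<length p}. ?h (Suc ` S)) = conv F (\<lambda>l. G (x # l)) p"
    by (simp add: Cons.IH nths_Cons image_iff Collect_neg_eq)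
  also have "(\<Sum>S\<in>Pow {..<length p}. ?h (insert 0 (Suc ` S))) = conv (\<lambda>l. F (x # l)) G p"
    by (simp add: Cons.IH nths_Cons image_iff Collect_neg_eq)
  finally show ?case by (simp add: add.commute)
qed simp

lemma length_nths_complement: "length (nths p S) + length (nths p (- S)) = length p"
proof -
  have "{i. i < length p \<and> i \<in> S} \<union> {i. i < length p \<and> i \<in> - S} = {..<length p}" by auto
  then have "length p = card ({i. i < length p \<and> i \<in> S} \<union> {i. i < length p \<and> i \<in> - S})" by simp
  also have "\<dots> = length (nths p S) + length (nths p (- S))"
    unfolding length_nths by (rule card_Un_disjoint) auto
  finally show ?thesis by simp
qed

lemma set_nths_complement: "set (nths p S) \<union> set (nths p (- S)) = set p"
proof -
  have "set (nths p S) \<union> set (nths p (- S)) =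
      (!) p ` ({i. i < length p \<and> i \<in> S} \<union> {i. i < length p \<and> i \<in> - S})"
    by (auto simp: set_nths)
  also have "{i. i < length p \<and> i \<in> S} \<union> {i. i < length p \<and> i \<in> - S} = {..<length p}" by auto
  finally show ?thesis by (auto simp: set_conv_nth)
qed

text \<open>Complementary sublists have lengths adding up to that of \<open>p\<close> and together
  carry all its letters, so they cannot both lie in the supports of \<open>F\<close> and
  \<open>G\<close>.\<close>

lemma conv_eq_0:
  assumes "\<And>l. \<not> (length l = a \<and> set l \<subseteq> A) \<Longrightarrow> F l = 0"
    and "\<And>l. \<not> (length l = b \<and> set l \<subseteq> A) \<Longrightarrow> G l = 0"
    and "\<not> (length p = a + b \<and> set p \<subseteq> A)"
  shows "conv F G p = 0"
  unfolding conv_eq_sum_nths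
proof (rule sum.neutral, rule ballI)
  fix S
  show "F (nths p S) * G (nths p (- S)) = 0"
  proof (cases "length (nths p S) = a \<and> set (nths p S) \<subseteq> A")
    case True
    then have "\<not> (length (nths p (- S)) = b \<and> set (nths p (- S)) \<subseteq> A)"
      using assms(3) length_nths_complement[of p S] by (auto simp: set_nths_complement[of p S, symmetric])
    from assms(2)[OF this] show ?thesis by simp
  next
    case False
    from assms(1)[OF this] show ?thesis by simp
  qed
qed

text \<open>A subset \<open>S\<close> of the positions picks out a sublist of length
  \<open>card S\<close>, so homogeneity of \<open>F\<close> leaves the \<open>a\<close>-element
  subsets. These also index the coset representatives constructed below.\<close>

lemma conv_eq_sum_card:
  assumes "\<And>l. length l \<noteq> a \<Longrightarrow> F l = 0"
  shows "conv F G p = (\<Sum>S | S \<subseteq> {..<length p} \<and> card S = a. F (nths p S) * G (nths p (- S)))"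
  unfolding conv_eq_sum_nths
proof (rule sum.mono_neutral_right)
  show "\<forall>S\<in>Pow {..<length p} - {S. S \<subseteq> {..<length p} \<and> card S = a}. F (nths p S) * G (nths p (- S)) = 0"
  proof
    fix S assume S: "S \<in> Pow {..<length p} - {S. S \<subseteq> {..<length p} \<and> card S = a}"
    then have "{i. i < length p \<and> i \<in> S} = S" by auto
    then have "length (nths p S) \<noteq> a" using S by (simp add: length_nths)
    then show "F (nths p S) * G (nths p (- S)) = 0" using assms by simp
  qed
qed auto


section \<open>Unshuffles as coset representatives\<close>

lemma nths_eq_map_filter: "nths xs S = map ((!) xs) (filter (\<lambda>i. i \<in> S) [0..<length xs])"
proof -
  have "zip xs [0..<length xs] = map (\<lambda>i. (xs ! i, i)) [0..<length xs]"
    by (rule nth_equalityI) simp_all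
  then show ?thesis by (simp add: nths_def filter_map o_def)
qed

definition unshuffle_list :: "nat \<Rightarrow> nat set \<Rightarrow> nat list" where
  "unshuffle_list m S = filter (\<lambda>i. i \<in> S) [0..<m] @ filter (\<lambda>i. i \<notin> S) [0..<m]"

text \<open>The list above is its one-line notation, extended by the identity as
  \<open>permutes\<close> demands. For \<open>S\<close> contained in \<open>{..<m}\<close> it is
  increasing on the first \<open>card S\<close> indices and on the remaining ones below
  \<open>m\<close>.\<close>

definition unshuffle :: "nat \<Rightarrow> nat set \<Rightarrow> nat \<Rightarrow> nat" where
  "unshuffle m S i = (if i < m then unshuffle_list m S ! i else i)"

lemma unshuffle_list_props:
  "length (unshuffle_list m S) = m" "distinct (unshuffle_list m S)" "set (unshuffle_list m S) = {..<m}"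
proof -
  show d: "distinct (unshuffle_list m S)" and s: "set (unshuffle_list m S) = {..<m}"
    by (auto simp: unshuffle_list_def)
  show "length (unshuffle_list m S) = m" using distinct_card[OF d] s by simp
qed

lemma unshuffle_permutes: "unshuffle m S permutes {..<m}"
proof (rule bij_imp_permutes)
  have "bij_betw ((!) (unshuffle_list m S)) {..<m} {..<m}"
    by (rule bij_betw_nth) (simp_all add: unshuffle_list_props)
  then show "bij_betw (unshuffle m S) {..<m} {..<m}"
    by (rule bij_betw_cong[THEN iffD1, rotated]) (simp add: unshuffle_def)
qed (simp add: unshuffle_def)

text \<open>Translates the action of a coset representative into the splitting of lists that
  \<open>conv\<close> sums over.\<close>

lemma permute_list_unshuffle:
  assumes "length z = m"
  shows "permute_list (unshuffle m S) z = nths z S @ nths z (- S)"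
proof -
  have "permute_list (unshuffle m S) z = map ((!) z) (unshuffle_list m S)"
    by (rule nth_equalityI)
      (simp_all add: permute_list_nth[OF unshuffle_permutes] unshuffle_list_props assms,
       simp add: permute_list_def assms unshuffle_def)
  then show ?thesis by (simp add: nths_eq_map_filter unshuffle_list_def assms)
qed

text \<open>Recovers \<open>S\<close> from its unshuffle, which yields both injectivity and the
  coset in which the unshuffle lies.\<close>

lemma unshuffle_image:
  assumes "S \<subseteq> {..<m}" "card S = a"
  shows "unshuffle m S ` {..<a} = S"
proof -
  let ?l = "filter (\<lambda>i. i \<in> S) [0..<m]"
  have set: "set ?l = S" using assms(1) by auto
  have len: "length ?l = a" using distinct_card[of ?l] set assms(2) by simp
  have "a \<le> m" using assms card_mono[of "{..<m}" S] by simp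
  then have "unshuffle m S ` {..<a} = (!) ?l ` {..<a}"
    using len by (intro image_cong) (auto simp: unshuffle_def unshuffle_list_def nth_append)
  also have "\<dots> = set ?l" using len by (auto simp: set_conv_nth)
  finally show ?thesis using set by simp
qed

section \<open>Left cosets of the Young subgroup as subsets of positions\<close>

lemma young_iff: "\<rho> \<in> young a b \<longleftrightarrow> \<rho> permutes {..<a + b} \<and> \<rho> ` {..<a} = {..<a}"
proof
  assume "\<rho> \<in> young a b"
  then obtain \<alpha> \<beta> where *: "\<rho> = block_perm a \<alpha> \<beta>" "\<alpha> permutes {..<a}"
    by (auto simp: young_def)
  have "\<rho> ` {..<a} = \<alpha> ` {..<a}" by (rule image_cong) (simp_all add: * block_perm_def)
  then show "\<rho> permutes {..<a + b} \<and> \<rho> ` {..<a} = {..<a}"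
    using young_permutes[OF \<open>\<rho> \<in> young a b\<close>] permutes_image[OF *(2)] by simp
next
  assume \<rho>: "\<rho> permutes {..<a + b} \<and> \<rho> ` {..<a} = {..<a}"
  \<comment> \<open>The restrictions of \<rho> to the two blocks, the second one shifted down by
    \<open>a\<close>.\<close>
  define \<alpha> where "\<alpha> i = (if i < a then \<rho> i else i)" for i
  define \<beta> where "\<beta> i = \<rho> (a + i) - a" for i
  have inj: "inj \<rho>" using \<rho> permutes_inj by blast
  \<comment> \<open>Indices from \<open>a\<close> on stay there, so the truncated subtraction in
    \<beta> loses nothing.\<close>
  have less: "\<rho> i < a \<longleftrightarrow> i < a" for i
    using \<rho> inj by (metis inj_image_mem_iff lessThan_iff)
  have less2: "\<rho> i < a + b \<longleftrightarrow> i < a + b" for i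
    using permutes_in_image[OF conjunct1[OF \<rho>], of i] by simp
  have "\<alpha> permutes {..<a}"
  proof (rule bij_imp_permutes)
    show "bij_betw \<alpha> {..<a} {..<a}"
      by (rule bij_betw_cong[THEN iffD1, of _ \<rho>])
        (use \<rho> inj in \<open>auto simp: \<alpha>_def bij_betw_def intro: inj_on_subset\<close>)
  qed (simp add: \<alpha>_def)
  moreover have "\<beta> permutes {..<b}"
  proof (rule bij_imp_permutes)
    have "inj_on \<beta> {..<b}"
    proof (rule inj_onI)
      fix i j assume "\<beta> i = \<beta> j"
      moreover have "a \<le> \<rho> (a + i)" "a \<le> \<rho> (a + j)" using less[of "a + i"] less[of "a + j"] by simp_all
      ultimately have "\<rho> (a + i) = \<rho> (a + j)" by (simp add: \<beta>_def)
      then show "i = j" using inj by (simp add: inj_eq)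
    qed
    moreover have "\<beta> ` {..<b} \<subseteq> {..<b}"
    proof clarsimp
      fix i assume "i < b"
      then show "\<beta> i < b" using less[of "a + i"] less2[of "a + i"] by (simp add: \<beta>_def)
    qed
    ultimately show "bij_betw \<beta> {..<b} {..<b}"
      by (simp add: bij_betw_def endo_inj_surj)
    show "\<beta> i = i" if "i \<notin> {..<b}" for i
      using permutes_not_in[OF conjunct1[OF \<rho>], of "a + i"] that by (simp add: \<beta>_def)
  qed
  moreover have "\<rho> = block_perm a \<alpha> \<beta>"
  proof
    show "\<rho> i = block_perm a \<alpha> \<beta> i" for i
      using less[of i] by (auto simp: block_perm_def \<alpha>_def \<beta>_def)
  qed
  ultimately show "\<rho> \<in> young a b" unfolding young_def by blast
qed

text \<open>The orbit-stabilizer correspondence: \<open>inv \<tau> \<circ> \<sigma>\<close>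
  stabilizes the first block exactly when \<sigma> and \<tau> send that block to the same
  set.\<close>

lemma mem_coset_young_iff:
  assumes \<sigma>: "\<sigma> permutes {..<a + b}" and \<tau>: "\<tau> permutes {..<a + b}"
  shows "\<sigma> \<in> (\<lambda>\<rho>. \<tau> \<circ> \<rho>) ` young a b \<longleftrightarrow> \<sigma> ` {..<a} = \<tau> ` {..<a}"
proof
  assume "\<sigma> \<in> (\<lambda>\<rho>. \<tau> \<circ> \<rho>) ` young a b"
  then obtain \<rho> where "\<rho> \<in> young a b" "\<sigma> = \<tau> \<circ> \<rho>" by (rule imageE)
  then show "\<sigma> ` {..<a} = \<tau> ` {..<a}" by (simp add: young_iff image_comp[symmetric] del: o_apply)
next
  assume eq: "\<sigma> ` {..<a} = \<tau> ` {..<a}"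
  have "(inv \<tau> \<circ> \<sigma>) ` {..<a} = (inv \<tau> \<circ> \<tau>) ` {..<a}" by (simp add: image_comp[symmetric] eq del: o_apply)
  then have "inv \<tau> \<circ> \<sigma> \<in> young a b"
    using permutes_compose[OF \<sigma> permutes_inv[OF \<tau>]] by (simp add: young_iff permutes_inv_o[OF \<tau>])
  then have "\<tau> \<circ> (inv \<tau> \<circ> \<sigma>) \<in> (\<lambda>\<rho>. \<tau> \<circ> \<rho>) ` young a b" by (rule imageI)
  then show "\<sigma> \<in> (\<lambda>\<rho>. \<tau> \<circ> \<rho>) ` young a b" by (simp add: o_assoc permutes_inv_o[OF \<tau>])
qed

text \<open>The coset of \<sigma> is determined by the image of the first block, and exactly one
  unshuffle in the family sends that block onto this image.\<close>

lemma coset_reps_unshuffle: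
  "coset_reps a b (unshuffle (a + b) ` {S. S \<subseteq> {..<a + b} \<and> card S = a})"
  unfolding coset_reps_def
proof (intro conjI allI impI)
  fix \<sigma> :: "nat \<Rightarrow> nat" assume \<sigma>: "\<sigma> permutes {..<a + b}"
  let ?\<U> = "{S. S \<subseteq> {..<a + b} \<and> card S = a}"
  let ?S = "\<sigma> ` {..<a}"
  have "?S \<subseteq> \<sigma> ` {..<a + b}" by (rule image_mono) simp
  moreover have "card ?S = a"
    using card_image[OF inj_on_subset[OF permutes_inj[OF \<sigma>]], of "{..<a}"] by simp
  ultimately have S: "?S \<in> ?\<U>" using permutes_image[OF \<sigma>] by simp
  show "\<exists>!\<tau>. \<tau> \<in> unshuffle (a + b) ` ?\<U> \<and> \<sigma> \<in> (\<lambda>\<rho>. \<tau> \<circ> \<rho>) ` young a b"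
  proof (rule ex1I[of _ "unshuffle (a + b) ?S"])
    show "unshuffle (a + b) ?S \<in> unshuffle (a + b) ` ?\<U> \<and>
        \<sigma> \<in> (\<lambda>\<rho>. unshuffle (a + b) ?S \<circ> \<rho>) ` young a b"
      using S by (simp add: mem_coset_young_iff[OF \<sigma> unshuffle_permutes] unshuffle_image)
    fix \<tau> assume *: "\<tau> \<in> unshuffle (a + b) ` ?\<U> \<and> \<sigma> \<in> (\<lambda>\<rho>. \<tau> \<circ> \<rho>) ` young a b"
    then obtain T where T: "T \<in> ?\<U>" "\<tau> = unshuffle (a + b) T" by blast
    then show "\<tau> = unshuffle (a + b) ?S"
      using conjunct2[OF *] by (simp add: mem_coset_young_iff[OF \<sigma> unshuffle_permutes] unshuffle_image)
  qed
qed (auto simp: unshuffle_permutes)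

lemma inj_on_unshuffle: "inj_on (unshuffle m) {S. S \<subseteq> {..<m} \<and> card S = a}"
  by (rule inj_on_inverseI[where g = "\<lambda>\<sigma>. \<sigma> ` {..<a}"]) (simp add: unshuffle_image)

text \<open>Used for equivariance of the product: acting by \<tau> translates the set of
  representatives, over which the sum is independent of choice.\<close>

lemma coset_reps_translate:
  assumes L: "coset_reps a b L" and \<tau>: "\<tau> permutes {..<a + b}"
  shows "coset_reps a b ((\<lambda>\<pi>. \<tau> \<circ> \<pi>) ` L)"
  unfolding coset_reps_def
proof (intro conjI allI impI)
  show "(\<lambda>\<pi>. \<tau> \<circ> \<pi>) ` L \<subseteq> {\<sigma>. \<sigma> permutes {..<a + b}}"
    using L permutes_compose[OF _ \<tau>] by (auto simp: coset_reps_def)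
  fix \<sigma> :: "nat \<Rightarrow> nat" assume \<sigma>: "\<sigma> permutes {..<a + b}"
  have shift: "\<sigma> \<in> (\<lambda>\<rho>. (\<tau> \<circ> \<pi>) \<circ> \<rho>) ` young a b \<longleftrightarrow> inv \<tau> \<circ> \<sigma> \<in> (\<lambda>\<rho>. \<pi> \<circ> \<rho>) ` young a b" for \<pi>
  proof -
    have "\<sigma> = (\<tau> \<circ> \<pi>) \<circ> \<rho> \<longleftrightarrow> inv \<tau> \<circ> \<sigma> = \<pi> \<circ> \<rho>" for \<rho>
      by (metis comp_assoc id_comp permutes_inv_o[OF \<tau>])
    then show ?thesis by (simp add: image_iff)
  qed
  \<comment> \<open>The representative of \<sigma> in the translated set is \<tau> composed with the
    representative of \<open>inv \<tau> \<circ> \<sigma>\<close> in \<open>L\<close>.\<close>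
  from L[unfolded coset_reps_def, THEN conjunct2, rule_format, OF permutes_compose[OF \<sigma> permutes_inv[OF \<tau>]]]
  obtain \<pi> where \<pi>: "\<pi> \<in> L" "inv \<tau> \<circ> \<sigma> \<in> (\<lambda>\<rho>. \<pi> \<circ> \<rho>) ` young a b"
    and unique: "\<And>\<pi>'. \<pi>' \<in> L \<Longrightarrow> inv \<tau> \<circ> \<sigma> \<in> (\<lambda>\<rho>. \<pi>' \<circ> \<rho>) ` young a b \<Longrightarrow> \<pi>' = \<pi>"
    by (elim ex1E) blast
  show "\<exists>!\<tau>'. \<tau>' \<in> (\<lambda>\<pi>. \<tau> \<circ> \<pi>) ` L \<and> \<sigma> \<in> (\<lambda>\<rho>. \<tau>' \<circ> \<rho>) ` young a b"
  proof (rule ex1I[of _ "\<tau> \<circ> \<pi>"])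
    show "\<tau> \<circ> \<pi> \<in> (\<lambda>\<pi>. \<tau> \<circ> \<pi>) ` L \<and> \<sigma> \<in> (\<lambda>\<rho>. (\<tau> \<circ> \<pi>) \<circ> \<rho>) ` young a b"
      using \<pi> shift[of \<pi>] by blast
    fix \<tau>' assume *: "\<tau>' \<in> (\<lambda>\<pi>. \<tau> \<circ> \<pi>) ` L \<and> \<sigma> \<in> (\<lambda>\<rho>. \<tau>' \<circ> \<rho>) ` young a b"
    obtain \<pi>' where "\<pi>' \<in> L" "\<tau>' = \<tau> \<circ> \<pi>'" using conjunct1[OF *] by (rule imageE)
    then show "\<tau>' = \<tau> \<circ> \<pi>"
      using conjunct2[OF *] shift[of \<pi>'] unique[of \<pi>'] by simp
  qed
qed


section \<open>Closure of Schur algebras under the product\<close>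

text \<open>Linearity holds summand by summand. Equivariance does not: \<tau> moves each summand to
  one for another representative, and only the whole sum is preserved.\<close>

lemma box_over_in_schur_endos:
  assumes f: "f \<in> schur_endos n a" and g: "g \<in> schur_endos n b" and L: "coset_reps a b L"
  shows "box_over n a b L f g \<in> schur_endos n (a + b)"
proof -
  let ?T = "tensor_map n a b f g"
  have lin: "?T \<in> tensor_endos n (a + b)"
    using f g by (intro tensor_map_linear) (auto simp: schur_endos_def)
  have perm: "\<sigma> permutes {..<a + b}" if "\<sigma> \<in> L" for \<sigma>
    using L that by (auto simp: coset_reps_def)
  have T_in: "?T v \<in> tensors n (a + b)" if "v \<in> tensors n (a + b)" for v
    using lin that by (auto simp: tensor_endos_def)
  have act_in: "act (inv \<sigma>) v \<in> tensors n (a + b)" if "\<sigma> \<in> L" "v \<in> tensors n (a + b)" for \<sigma> v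
    using permutes_inv[OF perm[OF that(1)]] that(2) by (rule act_in_tensors)
  have in1: "act \<sigma> (?T (act (inv \<sigma>) v)) \<in> tensors n (a + b)"
    if "\<sigma> \<in> L" "v \<in> tensors n (a + b)" for \<sigma> v
    by (rule act_in_tensors[OF perm[OF that(1)] T_in[OF act_in[OF that]]])
  have in2: "(\<lambda>u. v u + w u) \<in> tensors n (a + b)" "(\<lambda>u. c * v u) \<in> tensors n (a + b)"
    if "v \<in> tensors n (a + b)" "w \<in> tensors n (a + b)" for v w :: "'a tensor" and c
    using that by (simp_all add: tensors_def)
  have "box_over n a b L f g \<in> tensors n (a + b) \<rightarrow>\<^sub>E tensors n (a + b)"
  proof (rule PiE_I)
    fix v :: "'a tensor" assume v: "v \<in> tensors n (a + b)"
    have "act \<sigma> (?T (act (inv \<sigma>) v)) z = 0" if "\<sigma> \<in> L" "z \<notin> words n (a + b)" for \<sigma> z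
      using in1[OF that(1) v] that(2) by (simp add: tensors_def)
    then show "box_over n a b L f g v \<in> tensors n (a + b)"
      using v by (auto simp: box_over_def tensors_def intro!: sum.neutral)
  qed (simp add: box_over_def)
  moreover have "box_over n a b L f g (\<lambda>u. v u + w u) = (\<lambda>u. box_over n a b L f g v u + box_over n a b L f g w u)"
    if vw: "v \<in> tensors n (a + b)" "w \<in> tensors n (a + b)" for v w
  proof -
    have "act \<sigma> (?T (act (inv \<sigma>) (\<lambda>u. v u + w u))) z =
        act \<sigma> (?T (act (inv \<sigma>) v)) z + act \<sigma> (?T (act (inv \<sigma>) w)) z" if "\<sigma> \<in> L" for \<sigma> z
      using endo_add[OF lin act_in[OF that vw(1)] act_in[OF that vw(2)]] by (simp add: act_def)
    then show ?thesis using vw in2[OF vw] by (simp add: box_over_def sum.distrib)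
  qed
  moreover have "box_over n a b L f g (\<lambda>u. c * v u) = (\<lambda>u. c * box_over n a b L f g v u)"
    if v: "v \<in> tensors n (a + b)" for v c
  proof -
    have "act \<sigma> (?T (act (inv \<sigma>) (\<lambda>u. c * v u))) z = c * act \<sigma> (?T (act (inv \<sigma>) v)) z"
      if "\<sigma> \<in> L" for \<sigma> z
      using endo_scale[OF lin act_in[OF that v], of c] by (simp add: act_def)
    then show ?thesis using v in2[OF v v] by (simp add: box_over_def sum_distrib_left)
  qed
  moreover have "box_over n a b L f g (act \<tau> v) = act \<tau> (box_over n a b L f g v)"
    if \<tau>: "\<tau> permutes {..<a + b}" and v: "v \<in> tensors n (a + b)" for \<tau> v
  proof
    fix z
    have \<tau>v: "act \<tau> v \<in> tensors n (a + b)" using \<tau> v by (rule act_in_tensors)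
    have inj: "inj_on (\<lambda>\<pi>. \<tau> \<circ> \<pi>) L"
      using fun.inj_map[OF permutes_inj[OF \<tau>]] by (rule inj_on_subset) simp
    have summand: "act (\<tau> \<circ> \<pi>) (?T (act (inv (\<tau> \<circ> \<pi>)) (act \<tau> v))) = act \<tau> (act \<pi> (?T (act (inv \<pi>) v)))"
      if "\<pi> \<in> L" for \<pi>
    proof -
      note \<pi> = perm[OF that]
      have "inv (\<tau> \<circ> \<pi>) \<circ> \<tau> = inv \<pi>"
        using permutes_bij[OF \<tau>] permutes_bij[OF \<pi>]
        by (simp add: o_inv_distrib bij_is_inj bij_is_surj comp_assoc permutes_inv_o[OF \<tau>])
      then have "act (inv (\<tau> \<circ> \<pi>)) (act \<tau> v) = act (inv \<pi>) v" using act_act[OF \<tau> v] by simp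
      then show ?thesis using act_act[OF \<pi> T_in[OF act_in[OF that v]]] by simp
    qed
    \<comment> \<open>The sum is moved to the translated representatives. In each of them \<tau>
      factors out on the left, while its inverse cancels the \<tau> acting on
      \<open>v\<close>.\<close>
    have "box_over n a b L f g (act \<tau> v) z = box_over n a b ((\<lambda>\<pi>. \<tau> \<circ> \<pi>) ` L) f g (act \<tau> v) z"
      by (simp only: box_over_cong[OF f g L coset_reps_translate[OF L \<tau>]])
    also have "\<dots> = (\<Sum>\<pi>\<in>L. act \<tau> (act \<pi> (?T (act (inv \<pi>) v))) z)"
      using \<tau>v by (simp add: box_over_def sum.reindex[OF inj] summand)
    also have "\<dots> = act \<tau> (box_over n a b L f g v) z" using v by (simp add: box_over_def act_def)
    finally show "box_over n a b L f g (act \<tau> v) z = act \<tau> (box_over n a b L f g v) z" .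
  qed
  ultimately show ?thesis by (simp add: schur_endos_def tensor_endos_def)
qed

lemma scale_in_Schur:
  assumes "x \<in> Schur q n"
  shows "scale n q c x \<in> Schur q n"
proof (cases x)
  case (Endo f)
  with assms have q: "q \<noteq> 0" and f: "f \<in> schur_endos n q" by (auto simp: Schur_def split: if_splits)
  then have f': "f \<in> tensor_endos n q" by (simp add: schur_endos_def)
  have f_in: "f v \<in> tensors n q" if "v \<in> tensors n q" for v
    using f' that by (auto simp: tensor_endos_def)
  have in2: "(\<lambda>u. v u + w u) \<in> tensors n q" "(\<lambda>u. d * v u) \<in> tensors n q"
    if "v \<in> tensors n q" "w \<in> tensors n q" for v w :: "'a tensor" and d
    using that by (simp_all add: tensors_def)
  have "(\<lambda>v\<in>tensors n q. \<lambda>w. c * f v w) \<in> schur_endos n q"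
    using f_in endo_add[OF f'] endo_scale[OF f'] schur_endo_act[OF f] in2
    by (auto simp: schur_endos_def tensor_endos_def act_in_tensors distrib_left mult.left_commute)
      (simp_all add: act_def)
  then show ?thesis using q Endo by (simp add: Schur_def)
qed (use assms in \<open>auto simp: Schur_def split: if_splits\<close>)

lemma Schur_cases [consumes 1]:
  assumes "x \<in> Schur q n"
  obtains c where "q = 0" "x = Scalar c" | f where "q > 0" "x = Endo f" "f \<in> schur_endos n q"
  using assms by (auto simp: Schur_def split: if_splits)

lemma box_in_Schur:
  assumes x: "x \<in> Schur a n" and y: "y \<in> Schur b n"
  shows "box n a b x y \<in> Schur (a + b) n"
  using x
proof (cases rule: Schur_cases)
  case (1 c)
  then show ?thesis using scale_in_Schur[OF y] by simp
next
  case (2 f)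
  from y show ?thesis
  proof (cases rule: Schur_cases)
    case (1 c)
    then show ?thesis using scale_in_Schur[OF x] 2 by simp
  next
    case (2 g)
    obtain L where L: "coset_reps a b L" using coset_reps_exists by blast
    show ?thesis
      using 2 \<open>x = Endo f\<close> \<open>f \<in> schur_endos n a\<close> \<open>a > 0\<close> box_over_in_schur_endos[of f n a g b L] L
      by (simp add: Schur_def box_endo_eq[of f n a g b L])
  qed
qed


section \<open>Matrix coefficients\<close>

text \<open>The second components spell the basis vector that \<open>f\<close> is applied to, the
  first ones the coefficient read off; pairing them makes every splitting act on both. The default 0
  gives the homogeneous support that \<open>conv_eq_sum_card\<close> relies on.\<close>

fun coef :: "nat \<Rightarrow> nat \<Rightarrow> 'k::{comm_ring, comm_monoid_mult} schur \<Rightarrow> (nat \<times> nat) list \<Rightarrow> 'k" where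
  "coef n q (Scalar c) = (\<lambda>p. if p = [] then c else 0)"
| "coef n q (Endo f) = (\<lambda>p. if length p = q \<and> set p \<subseteq> {1..n} \<times> {1..n}
     then f (word_vec (map snd p)) (map fst p) else 0)"

lemma map_in_words:
  assumes "length p = q" "set p \<subseteq> {1..n} \<times> {1..n}"
  shows "map fst p \<in> words n q" "map snd p \<in> words n q"
  using assms by (auto simp: words_def)

lemma coef_eq_0:
  assumes "x \<in> Schur q n" "\<not> (length p = q \<and> set p \<subseteq> {1..n} \<times> {1..n})"
  shows "coef n q x p = 0"
  using assms by (cases rule: Schur_cases) auto

text \<open>A linear map is determined by its matrix, and off the tensors both maps are
  \<open>undefined\<close>; a scalar is read off at \<open>[]\<close>. Each equation among the
  operad axioms is reduced to coefficients this way.\<close>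

lemma coef_inject:
  assumes x: "x \<in> Schur q n" and y: "y \<in> Schur q n" and eq: "coef n q x = coef n q y"
  shows "x = y"
  using x
proof (cases rule: Schur_cases)
  case (1 c)
  from y obtain d where "y = Scalar d" by (cases rule: Schur_cases) (use 1 in auto)
  then show ?thesis using 1 fun_cong[OF eq, of "[]"] by simp
next
  case (2 f)
  from y obtain g where g: "y = Endo g" "g \<in> schur_endos n q"
    by (cases rule: Schur_cases) (use 2 in auto)
  have f': "f \<in> tensor_endos n q" and g': "g \<in> tensor_endos n q"
    using 2 g by (simp_all add: schur_endos_def)
  have entry: "f (word_vec u) z = g (word_vec u) z" if "u \<in> words n q" "z \<in> words n q" for u z
  proof -
    \<comment> \<open>The coefficient at \<open>zip z u\<close> is the matrix entry in row
      \<open>z\<close> and column \<open>u\<close>.\<close>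
    have "set (zip z u) \<subseteq> {1..n} \<times> {1..n}"
      using that by (auto simp: words_def dest: set_zip_leftD set_zip_rightD)
    then show ?thesis
      using fun_cong[OF eq, of "zip z u"] that by (simp add: 2 g words_def)
  qed
  have "f v = g v" if v: "v \<in> tensors n q" for v
  proof
    fix z
    show "f v z = g v z"
    proof (cases "z \<in> words n q")
      case True
      then show ?thesis by (simp add: endo_expand[OF f' v] endo_expand[OF g' v] entry)
    next
      case False
      have "f v \<in> tensors n q" "g v \<in> tensors n q" using f' g' v by (auto simp: tensor_endos_def)
      then show ?thesis using False by (simp add: tensors_def)
    qed
  qed
  then have "f = g"
    using f' g' by (intro extensionalityI[of _ "tensors n q"]) (auto simp: tensor_endos_def PiE_def)
  then show ?thesis using 2 g by simp
qed

lemma coef_scale: "coef n q (scale n q c x) p = c * coef n q x p"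
  by (cases x) (auto simp: word_vec_in_tensors map_in_words)

section \<open>Multiplicativity of the coefficients\<close>

lemma tens_word_vec:
  assumes "length u = a"
  shows "tens a (word_vec u) (word_vec w) = word_vec (u @ w)"
proof
  fix z
  have "take a z = u \<and> drop a z = w \<longleftrightarrow> z = u @ w"
    using assms by (metis append_eq_conv_conj)
  then show "tens a (word_vec u) (word_vec w) z = (word_vec (u @ w) :: 'a tensor) z"
    by (auto simp: tens_def word_vec_def)
qed

text \<open>Since \<open>act\<close> permutes the argument of a tensor, the index word of a basis
  vector moves by the inverse permutation.\<close>

lemma act_inv_word_vec:
  assumes "\<sigma> permutes {..<length w}"
  shows "act (inv \<sigma>) (word_vec w) = word_vec (permute_list \<sigma> w)"
proof -
  have "permute_list (inv \<sigma>) (permute_list \<sigma> w) = w"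
    using permute_list_compose[of "inv \<sigma>" w \<sigma>] permutes_inv[OF assms] permutes_inv_o(1)[OF assms] by simp
  then show ?thesis
    using act_word_vec[of "inv \<sigma>" "permute_list \<sigma> w"] permutes_inv[OF assms] by simp
qed

text \<open>As any representatives may be used, the unshuffles are taken. Each one contributes the
  product of the entries of \<open>f\<close> and \<open>g\<close> at the two parts into which it
  splits \<open>p\<close>.\<close>

lemma coef_box_endo:
  assumes f: "f \<in> schur_endos n a" and g: "g \<in> schur_endos n b"
    and p: "length p = a + b" "set p \<subseteq> {1..n} \<times> {1..n}"
  shows "box_endo n a b f g (word_vec (map snd p)) (map fst p) = conv (coef n a (Endo f)) (coef n b (Endo g)) p"
proof -
  let ?\<U> = "{S. S \<subseteq> {..<a + b} \<and> card S = a}"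
  let ?T = "tensor_map n a b f g"
  let ?z = "map fst p" and ?w = "map snd p"
  have f': "f \<in> tensor_endos n a" and g': "g \<in> tensor_endos n b"
    using f g by (simp_all add: schur_endos_def)
  have summand: "act (unshuffle (a + b) S) (?T (act (inv (unshuffle (a + b) S)) (word_vec ?w))) ?z =
      coef n a (Endo f) (nths p S) * coef n b (Endo g) (nths p (- S))" if S: "S \<in> ?\<U>" for S
  proof -
    let ?p1 = "nths p S" and ?p2 = "nths p (- S)"
    have "{i. i < a + b \<and> i \<in> S} = S" using S by auto
    then have l1: "length ?p1 = a" using S p(1) by (simp add: length_nths)
    then have l2: "length ?p2 = b" using length_nths_complement[of p S] p(1) by simp
    have s: "set ?p1 \<subseteq> {1..n} \<times> {1..n}" "set ?p2 \<subseteq> {1..n} \<times> {1..n}"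
      using set_nths_complement[of p S] p(2) by auto
    \<comment> \<open>The inner action splits the column word along \<open>S\<close>; the outer
      action will split the row word along the same \<open>S\<close>.\<close>
    have "act (inv (unshuffle (a + b) S)) (word_vec ?w :: 'a tensor) = word_vec (map snd ?p1 @ map snd ?p2)"
      using p(1) by (simp add: act_inv_word_vec unshuffle_permutes permute_list_unshuffle nths_map)
    also have "\<dots> = tens a (word_vec (map snd ?p1)) (word_vec (map snd ?p2))"
      using l1 by (simp add: tens_word_vec)
    finally have "?T (act (inv (unshuffle (a + b) S)) (word_vec ?w)) =
        tens a (f (word_vec (map snd ?p1))) (g (word_vec (map snd ?p2)))"
      using tensor_map_tens[OF f' g'] map_in_words(2)[OF l1 s(1)] map_in_words(2)[OF l2 s(2)]
      by (simp add: word_vec_in_tensors)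
    then show ?thesis
      using p(1) l1 l2 s by (simp add: act_def tens_def permute_list_unshuffle nths_map)
  qed
  have "box_endo n a b f g (word_vec ?w) ?z = (\<Sum>S\<in>?\<U>.
      act (unshuffle (a + b) S) (?T (act (inv (unshuffle (a + b) S)) (word_vec ?w))) ?z)"
    by (simp add: box_endo_eq[OF f g coset_reps_unshuffle] box_over_def
        sum.reindex[OF inj_on_unshuffle] word_vec_in_tensors[OF map_in_words(2)[OF p]])
  also have "\<dots> = (\<Sum>S\<in>?\<U>. coef n a (Endo f) (nths p S) * coef n b (Endo g) (nths p (- S)))"
    by (rule sum.cong[OF refl summand])
  also have "\<dots> = conv (coef n a (Endo f)) (coef n b (Endo g)) p"
    by (subst conv_eq_sum_card[of a]) (simp_all add: p(1))
  finally show ?thesis .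
qed

text \<open>Carries the monoid laws of \<open>conv\<close> over to \<open>box\<close>. For two
  endomorphisms, lists of the wrong length or with letters out of range give 0 on both
  sides.\<close>

lemma coef_box:
  assumes x: "x \<in> Schur a n" and y: "y \<in> Schur b n"
  shows "coef n (a + b) (box n a b x y) = conv (coef n a x) (coef n b y)"
proof
  fix p
  show "coef n (a + b) (box n a b x y) p = conv (coef n a x) (coef n b y) p"
    using x
  proof (cases rule: Schur_cases)
    case (1 c)
    then show ?thesis by (simp add: coef_scale conv_scale_unit)
  next
    case (2 f)
    note f = this
    from y show ?thesis
    proof (cases rule: Schur_cases)
      case (1 c)
      then show ?thesis
        \<comment> \<open>The scalar is now the right factor, so \<open>conv_scale_unit\<close>
          applies after commuting.\<close>
        using f coef_scale[of n a c x p] conv_scale_unit[of c "coef n a x" p]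
          conv_commute[of "\<lambda>p. if p = [] then c else 0" "coef n a x" p]
        by (simp del: scale.simps coef.simps(2))
    next
      case (2 g)
      show ?thesis
      proof (cases "length p = a + b \<and> set p \<subseteq> {1..n} \<times> {1..n}")
        case True
        then show ?thesis using f 2 coef_box_endo[of f n a g b p] by simp
      next
        case False
        then have "conv (coef n a x) (coef n b y) p = 0"
          by (intro conv_eq_0[OF coef_eq_0[OF x] coef_eq_0[OF y]])
        moreover have "coef n (a + b) (box n a b x y) p = 0"
          by (rule coef_eq_0[OF box_in_Schur[OF x y] False])
        ultimately show ?thesis by simp
      qed
    qed
  qed
qed


section \<open>Iterated products\<close>

text \<open>Each step absorbs the head of the list into the accumulator, so its degree and value
  vary in the induction; \<open>conv.assoc\<close> undoes the left nesting.\<close>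

lemma box_list_in_Schur_coef:
  assumes "x \<in> Schur a n" "\<forall>(b, y)\<in>set ps. y \<in> Schur b n"
  shows "box_list n a x ps \<in> Schur (a + sum_list (map fst ps)) n \<and>
    coef n (a + sum_list (map fst ps)) (box_list n a x ps) =
      conv (coef n a x) (conv_list (map (\<lambda>(b, y). coef n b y) ps))"
  using assms
proof (induction ps arbitrary: a x)
  case (Cons p ps)
  obtain b y where p: "p = (b, y)" by (cases p)
  have y: "y \<in> Schur b n" using Cons.prems p by simp
  have "\<forall>(b, y)\<in>set ps. y \<in> Schur b n" using Cons.prems by simp
  from Cons.IH[OF box_in_Schur[OF Cons.prems(1) y] this] show ?case
    by (simp add: p coef_box[OF Cons.prems(1) y] conv.assoc add.assoc)
qed simp

text \<open>Arity \<open>k\<close> means degree \<open>k - 1\<close>. Adding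
  \<open>length ks\<close> to the sum of degrees states the count without a truncated difference
  outside the summands.\<close>

lemma sum_list_diff_1:
  assumes "\<forall>k\<in>set ks. 1 \<le> k"
  shows "length ks + sum_list (map (\<lambda>k. k - 1) ks) = sum_list ks"
  using assms by (induction ks) auto

text \<open>Turns a composite into a product of coefficient families, so that the operad equations
  become identities in the monoid of \<open>conv\<close>.\<close>

lemma schur_comp_in_Schur_coef:
  assumes ks: "ks \<noteq> []" "\<forall>k\<in>set ks. 1 \<le> k" and \<theta>: "\<theta> \<in> Schur (length ks - 1) n"
    and \<theta>s: "list_all2 (\<lambda>\<phi> k. \<phi> \<in> Schur (k - 1) n) \<theta>s ks"
  shows "schur_comp n ks \<theta> \<theta>s \<in> Schur (sum_list ks - 1) n"
    and "coef n (sum_list ks - 1) (schur_comp n ks \<theta> \<theta>s) =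
      conv (coef n (length ks - 1) \<theta>) (conv_list (map2 (\<lambda>k \<phi>. coef n (k - 1) \<phi>) ks \<theta>s))"
proof -
  let ?ps = "zip (map (\<lambda>k. k - 1) ks) \<theta>s"
  have len: "length \<theta>s = length ks" using \<theta>s by (rule list_all2_lengthD)
  have "\<forall>(b, y)\<in>set ?ps. y \<in> Schur b n"
    using \<theta>s by (auto simp: list_all2_conv_all_nth set_zip)
  note * = box_list_in_Schur_coef[OF \<theta> this]
  \<comment> \<open>With at least one input, \<open>length ks - 1\<close> is not truncated, and the
    degrees add up to the arity of the composite minus 1.\<close>
  have "length ks \<ge> 1" using ks(1) by (cases ks) auto
  then have "length ks - 1 + sum_list (map fst ?ps) = sum_list ks - 1"
    using sum_list_diff_1[OF ks(2)] len by simp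
  moreover have "map (\<lambda>(b, y). coef n b y) ?ps = map2 (\<lambda>k \<phi>. coef n (k - 1) \<phi>) ks \<theta>s"
    by (simp add: map_zip_map)
  ultimately show "schur_comp n ks \<theta> \<theta>s \<in> Schur (sum_list ks - 1) n"
    and "coef n (sum_list ks - 1) (schur_comp n ks \<theta> \<theta>s) =
      conv (coef n (length ks - 1) \<theta>) (conv_list (map2 (\<lambda>k \<phi>. coef n (k - 1) \<phi>) ks \<theta>s))"
    using * by (simp_all add: schur_comp_def)
qed

lemma map2_concat:
  assumes "list_all2 (list_all2 P) yss xss"
  shows "map2 h (concat xss) (concat yss) = concat (map2 (map2 h) xss yss)"
  using assms by (induction rule: list_all2_induct) (auto dest: list_all2_lengthD)

lemma map_nth_eq_map2:
  assumes "length ys = length xs"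
  shows "map (\<lambda>i. h (xs ! i) (ys ! i)) [0..<length xs] = map2 h xs ys"
  by (rule nth_equalityI) (simp_all add: assms)

theorem proposition6p8:
  fixes n :: nat
  assumes "n \<ge> 1"
  shows "operad (\<lambda>m. Schur (m - 1) n :: 'k::{comm_ring, comm_monoid_mult} schur set)
           (Scalar 1) (schur_comp n)"
proof
  show "(Scalar 1 :: 'k schur) \<in> Schur (1 - 1) n" by (simp add: Schur_def)
  show "schur_comp n ks \<theta> \<theta>s \<in> Schur (sum_list ks - 1) n"
    if "ks \<noteq> []" "\<forall>k\<in>set ks. 1 \<le> k" "\<theta> \<in> Schur (length ks - 1) n"
      "list_all2 (\<lambda>\<phi> k. \<phi> \<in> Schur (k - 1) n) \<theta>s ks" for ks and \<theta> :: "'k schur" and \<theta>s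
    using that by (rule schur_comp_in_Schur_coef(1))
  show "schur_comp n (replicate m 1) \<theta> (replicate m (Scalar 1)) = \<theta>"
    if m: "1 \<le> m" and \<theta>: "\<theta> \<in> Schur (m - 1) n" for m and \<theta> :: "'k schur"
  proof -
    let ?ks = "replicate m (1::nat)" and ?\<theta>s = "replicate m (Scalar 1 :: 'k schur)"
    have *: "?ks \<noteq> []" "\<forall>k\<in>set ?ks. 1 \<le> k" "\<theta> \<in> Schur (length ?ks - 1) n"
      "list_all2 (\<lambda>\<phi> k. \<phi> \<in> Schur (k - 1) n) ?\<theta>s ?ks"
      using m \<theta> by (auto simp: list_all2_conv_all_nth Schur_def)
    \<comment> \<open>Arity 1 is degree 0, where the coefficient family of \<open>Scalar 1\<close>
      is the unit of \<open>conv\<close>.\<close>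
    have "map2 (\<lambda>k \<phi>. coef n (k - 1) \<phi>) ?ks ?\<theta>s = replicate m conv_unit"
      by (simp add: zip_replicate conv_unit_def[abs_def])
    then have "coef n (m - 1) (schur_comp n ?ks \<theta> ?\<theta>s) = coef n (m - 1) \<theta>"
      using schur_comp_in_Schur_coef(2)[OF *]
      by (simp only: conv_list_replicate_unit conv.right_neutral) (simp add: sum_list_replicate)
    then show ?thesis
      using schur_comp_in_Schur_coef(1)[OF *] \<theta> by (intro coef_inject) (simp_all add: sum_list_replicate)
  qed
  show "schur_comp n [m] (Scalar 1) [\<theta>] = \<theta>" if "1 \<le> m" "\<theta> \<in> Schur (m - 1) n"
    for m and \<theta> :: "'k schur"
  proof -
    have *: "[m] \<noteq> []" "\<forall>k\<in>set [m]. 1 \<le> k" "(Scalar 1 :: 'k schur) \<in> Schur (length [m] - 1) n"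
      "list_all2 (\<lambda>\<phi> k. \<phi> \<in> Schur (k - 1) n) [\<theta>] [m]"
      using that by (simp_all add: Schur_def)
    have "coef n (m - 1) (schur_comp n [m] (Scalar 1) [\<theta>]) = coef n (m - 1) \<theta>"
      using schur_comp_in_Schur_coef(2)[OF *] by (simp add: conv_scale_unit fun_eq_iff)
    then show ?thesis
      using schur_comp_in_Schur_coef(1)[OF *] that by (intro coef_inject) simp_all
  qed
  fix kss and \<theta> :: "'k schur" and \<theta>s :: "'k schur list" and \<theta>ss :: "'k schur list list"
  assume kss: "kss \<noteq> []" "\<forall>ks\<in>set kss. ks \<noteq> [] \<and> (\<forall>k\<in>set ks. 1 \<le> k)"
    and \<theta>: "\<theta> \<in> Schur (length kss - 1) n"
    and \<theta>s: "list_all2 (\<lambda>\<phi> ks. \<phi> \<in> Schur (length ks - 1) n) \<theta>s kss"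
    and \<theta>ss: "list_all2 (list_all2 (\<lambda>\<psi> k. \<psi> \<in> Schur (k - 1) n)) \<theta>ss kss"
  let ?m = "length kss"
  let ?C = "\<lambda>k \<phi>. coef n (k - 1) (\<phi> :: 'k schur)"
  define \<phi>s where "\<phi>s = map (\<lambda>i. schur_comp n (kss ! i) (\<theta>s ! i) (\<theta>ss ! i)) [0..<?m]"
  have len: "length \<theta>s = ?m" "length \<theta>ss = ?m"
    using \<theta>s \<theta>ss by (auto dest: list_all2_lengthD)
  have inner: "kss ! i \<noteq> []" "\<forall>k\<in>set (kss ! i). 1 \<le> k" "\<theta>s ! i \<in> Schur (length (kss ! i) - 1) n"
    "list_all2 (\<lambda>\<phi> k. \<phi> \<in> Schur (k - 1) n) (\<theta>ss ! i) (kss ! i)" if "i < ?m" for i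
    using kss(2) \<theta>s \<theta>ss that by (auto simp: list_all2_conv_all_nth[of _ _ kss])
  have pos: "1 \<le> sum_list ks" "1 \<le> length ks" if "ks \<in> set kss" for ks
  proof -
    from kss(2) that obtain k ks' where "ks = k # ks'" "1 \<le> k" by (cases ks) auto
    then show "1 \<le> sum_list ks" "1 \<le> length ks" by simp_all
  qed
  \<comment> \<open>Besides the inner composites three more occur: \<theta> with the inner
    composites (\<open>outer\<close>), \<theta> with the \<theta>_i (\<open>first\<close>), and the
    latter result with the flattened inputs (\<open>second\<close>).\<close>
  have outer: "map sum_list kss \<noteq> []" "\<forall>k\<in>set (map sum_list kss). 1 \<le> k"
    "\<theta> \<in> Schur (length (map sum_list kss) - 1) n"
    "list_all2 (\<lambda>\<phi> k. \<phi> \<in> Schur (k - 1) n) \<phi>s (map sum_list kss)"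
    using kss(1) \<theta> pos schur_comp_in_Schur_coef(1)[OF inner]
    by (auto simp: \<phi>s_def list_all2_conv_all_nth)
  have first: "map length kss \<noteq> []" "\<forall>k\<in>set (map length kss). 1 \<le> k"
    "\<theta> \<in> Schur (length (map length kss) - 1) n"
    "list_all2 (\<lambda>\<phi> k. \<phi> \<in> Schur (k - 1) n) \<theta>s (map length kss)"
    using kss(1) \<theta> pos \<theta>s by (auto simp: list_all2_conv_all_nth)
  have second: "concat kss \<noteq> []" "\<forall>k\<in>set (concat kss). 1 \<le> k"
    "schur_comp n (map length kss) \<theta> \<theta>s \<in> Schur (length (concat kss) - 1) n"
    "list_all2 (\<lambda>\<phi> k. \<phi> \<in> Schur (k - 1) n) (concat \<theta>ss) (concat kss)"
  proof -
    show "concat kss \<noteq> []" using kss by (cases kss) auto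
    show "\<forall>k\<in>set (concat kss). 1 \<le> k" using kss(2) by auto
    show "schur_comp n (map length kss) \<theta> \<theta>s \<in> Schur (length (concat kss) - 1) n"
      using schur_comp_in_Schur_coef(1)[OF first] by (simp add: length_concat)
    show "list_all2 (\<lambda>\<phi> k. \<phi> \<in> Schur (k - 1) n) (concat \<theta>ss) (concat kss)"
      \<comment> \<open>Parametricity of \<open>concat\<close> flattens the nested
        \<open>list_all2\<close>.\<close>
      using concat_transfer[THEN rel_funD, OF \<theta>ss] .
  qed
  have sum: "sum_list (map sum_list kss) = sum_list (concat kss)" by (induction kss) simp_all
  have "map2 ?C (map sum_list kss) \<phi>s =
      map (\<lambda>i. ?C (sum_list (kss ! i)) (schur_comp n (kss ! i) (\<theta>s ! i) (\<theta>ss ! i))) [0..<?m]"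
    by (rule nth_equalityI) (simp_all add: \<phi>s_def)
  also have "\<dots> = map (\<lambda>i. conv (?C (length (kss ! i)) (\<theta>s ! i))
      (conv_list (map2 ?C (kss ! i) (\<theta>ss ! i)))) [0..<?m]"
    by (intro map_cong refl schur_comp_in_Schur_coef(2) inner) simp_all
  \<comment> \<open>The factors on the left come grouped by \<open>i\<close>, each \<theta>_i
    followed by its inputs; they are regrouped as all \<theta>_i first, then all inputs.\<close>
  finally have "conv_list (map2 ?C (map sum_list kss) \<phi>s) =
      conv (conv_list (map (\<lambda>i. ?C (length (kss ! i)) (\<theta>s ! i)) [0..<?m]))
        (conv_list (map (\<lambda>i. conv_list (map2 ?C (kss ! i) (\<theta>ss ! i))) [0..<?m]))"
    by (simp only: conv_list_map_conv)
  also have "map (\<lambda>i. ?C (length (kss ! i)) (\<theta>s ! i)) [0..<?m] = map2 ?C (map length kss) \<theta>s"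
    using len by (intro nth_equalityI) simp_all
  also have "conv_list (map (\<lambda>i. conv_list (map2 ?C (kss ! i) (\<theta>ss ! i))) [0..<?m]) =
      conv_list (map2 ?C (concat kss) (concat \<theta>ss))"
    unfolding map2_concat[OF \<theta>ss] conv_list_concat map_nth_eq_map2[OF len(2), symmetric]
    by (simp add: o_def)
  \<comment> \<open>What remains is to rebracket: on the left \<theta> multiplies the whole
    regrouped product, on the right it is first multiplied with the \<theta>_i.\<close>
  finally have "coef n (sum_list (concat kss) - 1) (schur_comp n (map sum_list kss) \<theta> \<phi>s) =
      coef n (sum_list (concat kss) - 1)
        (schur_comp n (concat kss) (schur_comp n (map length kss) \<theta> \<theta>s) (concat \<theta>ss))"
    using schur_comp_in_Schur_coef(2)[OF outer] schur_comp_in_Schur_coef(2)[OF first]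
      schur_comp_in_Schur_coef(2)[OF second]
    by (simp add: sum length_concat conv.assoc)
  then show "schur_comp n (map sum_list kss) \<theta>
      (map (\<lambda>i. schur_comp n (kss ! i) (\<theta>s ! i) (\<theta>ss ! i)) [0..<?m]) =
    schur_comp n (concat kss) (schur_comp n (map length kss) \<theta> \<theta>s) (concat \<theta>ss)"
    unfolding \<phi>s_def[symmetric]
    using schur_comp_in_Schur_coef(1)[OF outer] schur_comp_in_Schur_coef(1)[OF second]
    by (intro coef_inject) (simp_all add: sum)
qed

end
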